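(* Let $X_0,X_1,\dots,X_n$ be real vector fields on a bounded domain $\Omega\subset\mathbb{R}^p$ satisfying (A1) and (A2) for some integer $r\ge 2$, and let $\Omega'\Subset\Omega$. For $x_0\in\Omega'$ let $S_i^{x_0}$ ($i=0,\dots,n$) be the smooth approximating vector fields at $x_0$. There exist positive constants $c_1,c_2,r_0$ depending on $\Omega,\Omega'$ and the $X_i$'s, but not on $x_0$, such that $$B_{S^{x_0}}(x_0,c_1\rho)\subset B_X(x_0,\rho)\subset B_{S^{x_0}}(x_0,c_2\rho)$$ for any $x_0\in\Omega'$ and any $0<\rho<r_0$.
   Context: $\Omega'\Subset\Omega$ means $\Omega'$ is a domain (connected open set) with $\overline{\Omega'}$ compact and contained in $\Omega$. Weights: $p_0=2$ and $p_i=1$ for $i=1,\dots,n$. For a multiindex $I=(i_1,\dots,i_k)$ with entries in $\{0,1,\dots,n\}$, the weight is $|I|=\sum_{j=1}^k p_{i_j}$, and for a system $Y=(Y_0,\dots,Y_n)$ of vector fields $Y_{[I]}=[Y_{i_1},[Y_{i_2},\dots[Y_{i_{k-1}},Y_{i_k}]\dots]]$ (with $Y_{[I]}=Y_{i_1}$ if $I=(i_1)$), where $[X,Y]=XY-YX$. $(Y_{[I]})_x$ denotes $Y_{[I]}$ evaluated at $x$. Assumptions, for an integer $r\ge2$: (A1) the coefficients of $X_1,\dots,X_n$ belong to $C^{r-1}(\overline\Omega)$ and the coefficients of $X_0$ belong to $C^{r-2}(\overline\Omega)$; (A2) the vectors $\{(X_{[I]})_x\}_{|I|\le r}$ span $\mathbb{R}^p$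 at every $x\in\Omega$. Approximating fields: writing $X_i=\sum_{j=1}^p b_{ij}(x)\partial_{x_j}$, set $S_i^{x_0}=\sum_{j=1}^p p^r_{ij}(x)\partial_{x_j}$, where $p^r_{ij}$ is the Taylor polynomial of $b_{ij}$ centered at $x_0$ of order $r-p_i$. Distances and balls: for a system $Y$ of vector fields ($Y=X$ or $Y=S^{x_0}$) and $\delta>0$ let $C_Y(\delta)$ be the class of absolutely continuous maps $\varphi:[0,1]\to\Omega$ with $\varphi'(t)=\sum_{|I|\le r}a_I(t)(Y_{[I]})_{\varphi(t)}$ for a.e. $t$, with $a_I$ measurable, $|a_I(t)|\le\delta^{|I|}$; $d_Y(x,y)=\inf\{\delta>0:\exists\varphi\in C_Y(\delta),\varphi(0)=x,\varphi(1)=y\}$ (with $\inf\emptyset=+\infty$), and $B_Y(x,\rho)=\{y\in\Omega:d_Y(x,y)<\rho\}$. Dependence of constants (with $p,n,r,\Omega$ fixed): "depending on $\Omega'$ and the $X_i$'s" means depending on: (i) $\Omega'$; (ii) the $C^{r-1}(\overline\Omega)$ norms of the coefficients of $X_1,\dots,X_n$ and the $C^{r-2}(\overline\Omega)$ norms of those of $X_0$; (iii) the moduli of continuity on $\overline\Omega$ of the highest order derivatives of the coefficients of the $X_i$'s; (iv) a constant $c_0>0$ with $\inf_{x\in\Omega'}\max_{|I_1|,\dots,|I_p|\le r}|\det((X_{[I_1]})_x,\dots,(X_{[I_p]})_x)|\ge c_0$. *)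

theory Defs
  imports "HOL-Analysis.Analysis"
begin

section \<open>Domains\<close>

definition domain_set :: "('a::topological_space) set \<Rightarrow> bool" where
  "domain_set \<Omega> \<longleftrightarrow> open \<Omega> \<and> connected \<Omega>"

definition compactly_inside :: "('a::topological_space) set \<Rightarrow> 'a set \<Rightarrow> bool" where
  "compactly_inside \<Omega>' \<Omega> \<longleftrightarrow> domain_set \<Omega>' \<and> compact (closure \<Omega>') \<and> closure \<Omega>' \<subseteq> \<Omega>"


section \<open>Iterated partial derivatives and $C^k$ classes up to the boundary\<close>

definition pderiv1 :: "'p \<Rightarrow> (real ^ 'p \<Rightarrow> real) \<Rightarrow> real ^ 'p \<Rightarrow> real" where
  "pderiv1 j f x = frechet_derivative f (at x) (axis j 1)"

text \<open>A derivative of order \<open>m\<close> is indexed by the list of its \<open>m\<close> coordinate directions.\<close>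

fun pderivs :: "'p list \<Rightarrow> (real ^ 'p \<Rightarrow> real) \<Rightarrow> real ^ 'p \<Rightarrow> real" where
  "pderivs [] f = f"
| "pderivs (j # \<alpha>) f = pderiv1 j (pderivs \<alpha> f)"

text \<open>\<open>f\<close> belongs to $C^k(\overline\Omega)$: it is \<open>k\<close> times differentiable in \<open>\<Omega>\<close>, and every
  partial derivative of order at most \<open>k\<close> (\<open>f\<close> included) is continuous in \<open>\<Omega>\<close> and extends
  continuously to the closure. Values of \<open>f\<close> outside \<open>\<Omega>\<close> play no role.\<close>

definition Ck_closure :: "nat \<Rightarrow> (real ^ 'p) set \<Rightarrow> (real ^ 'p \<Rightarrow> real) \<Rightarrow> bool" where
  "Ck_closure k \<Omega> f \<longleftrightarrow>
     (\<forall>\<alpha>. length \<alpha> < k \<longrightarrow> (\<forall>x\<in>\<Omega>. pderivs \<alpha> f differentiable (at x))) \<and>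
     (\<forall>\<alpha>. length \<alpha> \<le> k \<longrightarrow>
        (\<exists>g. continuous_on (closure \<Omega>) g \<and> (\<forall>x\<in>\<Omega>. g x = pderivs \<alpha> f x)))"

text \<open>The supremum is taken over \<open>\<Omega>\<close>; for \<open>f\<close> in $C^k(\overline\Omega)$ it equals the one over the
  closure.\<close>

definition Ck_norm :: "nat \<Rightarrow> (real ^ 'p) set \<Rightarrow> (real ^ 'p \<Rightarrow> real) \<Rightarrow> real" where
  "Ck_norm k \<Omega> f = (SUP (\<alpha>, x) \<in> {\<alpha>. length \<alpha> \<le> k} \<times> \<Omega>. \<bar>pderivs \<alpha> f x\<bar>)"

definition closure_extension :: "(real ^ 'p) set \<Rightarrow> (real ^ 'p \<Rightarrow> real) \<Rightarrow> real ^ 'p \<Rightarrow> real" where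
  "closure_extension \<Omega> f x = Lim (at x within \<Omega>) f"

definition continuity_modulus :: "(real ^ 'p) set \<Rightarrow> (real ^ 'p \<Rightarrow> real) \<Rightarrow> real \<Rightarrow> real" where
  "continuity_modulus \<Omega> f t =
     (SUP (x, y) \<in> {(x, y). x \<in> closure \<Omega> \<and> y \<in> closure \<Omega> \<and> dist x y \<le> t}.
        \<bar>closure_extension \<Omega> f x - closure_extension \<Omega> f y\<bar>)"

text \<open>Summing over all lists of length \<open>m\<close> counts a multi-index $\alpha$ of order \<open>m\<close> exactly
  $m!/\alpha!$ times, whence the factor $1/m!$ in place of the usual $1/\alpha!$.\<close>

definition taylor_poly :: "nat \<Rightarrow> (real ^ 'p \<Rightarrow> real) \<Rightarrow> real ^ 'p \<Rightarrow> real ^ 'p \<Rightarrow> real" where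
  "taylor_poly k f x0 x =
     (\<Sum>m\<le>k. \<Sum>\<alpha> | length \<alpha> = m.
        pderivs \<alpha> f x0 / fact m * (\<Prod>j\<leftarrow>\<alpha>. x $ j - x0 $ j))"


section \<open>Weights and iterated commutators\<close>

definition wt :: "nat \<Rightarrow> nat" where
  "wt i = (if i = 0 then 2 else 1)"

definition weight :: "nat list \<Rightarrow> nat" where
  "weight I = (\<Sum>i\<leftarrow>I. wt i)"

definition multiindices :: "nat \<Rightarrow> nat \<Rightarrow> nat list set" where
  "multiindices n r = {I. I \<noteq> [] \<and> set I \<subseteq> {0..n} \<and> weight I \<le> r}"

text \<open>The commutator $XY-YX$ of $X=\sum_k X_k\partial_k$ and $Y=\sum_k Y_k\partial_k$ has
  \<open>j\<close>-th coefficient $\sum_k (X_k\partial_k Y_j - Y_k\partial_k X_j)$.\<close>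

definition lie_bracket ::
    "(real ^ 'p \<Rightarrow> real ^ 'p) \<Rightarrow> (real ^ 'p \<Rightarrow> real ^ 'p) \<Rightarrow> real ^ 'p \<Rightarrow> real ^ 'p" where
  "lie_bracket X Y x =
     (\<chi> j. \<Sum>k\<in>UNIV. X x $ k * pderiv1 k (\<lambda>y. Y y $ j) x - Y x $ k * pderiv1 k (\<lambda>y. X y $ j) x)"

text \<open>The value at the empty list is a dummy: the empty list is not in \<^const>\<open>multiindices\<close>.\<close>

fun iter_bracket :: "(nat \<Rightarrow> real ^ 'p \<Rightarrow> real ^ 'p) \<Rightarrow> nat list \<Rightarrow> real ^ 'p \<Rightarrow> real ^ 'p" where
  "iter_bracket Y [] = (\<lambda>x. 0)"
| "iter_bracket Y [i] = Y i"
| "iter_bracket Y (i # j # I) = lie_bracket (Y i) (iter_bracket Y (j # I))"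


section \<open>Assumptions on the vector fields and their approximation\<close>

text \<open>Only the fields \<open>X 0, \<dots>, X n\<close> matter; \<open>X i\<close> for \<open>i > n\<close> is irrelevant.\<close>

definition assumption_A1 ::
    "(real ^ 'p) set \<Rightarrow> nat \<Rightarrow> nat \<Rightarrow> (nat \<Rightarrow> real ^ 'p \<Rightarrow> real ^ 'p) \<Rightarrow> bool" where
  "assumption_A1 \<Omega> n r X \<longleftrightarrow>
     (\<forall>i\<in>{1..n}. \<forall>j. Ck_closure (r - 1) \<Omega> (\<lambda>x. X i x $ j)) \<and>
     (\<forall>j. Ck_closure (r - 2) \<Omega> (\<lambda>x. X 0 x $ j))"

definition assumption_A2 ::
    "(real ^ 'p) set \<Rightarrow> nat \<Rightarrow> nat \<Rightarrow> (nat \<Rightarrow> real ^ 'p \<Rightarrow> real ^ 'p) \<Rightarrow> bool" where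
  "assumption_A2 \<Omega> n r X \<longleftrightarrow>
     (\<forall>x\<in>\<Omega>. span ((\<lambda>I. iter_bracket X I x) ` multiindices n r) = UNIV)"

definition approx_field ::
    "nat \<Rightarrow> (nat \<Rightarrow> real ^ 'p \<Rightarrow> real ^ 'p) \<Rightarrow> real ^ 'p \<Rightarrow> nat \<Rightarrow> real ^ 'p \<Rightarrow> real ^ 'p" where
  "approx_field r X x0 i x = (\<chi> j. taylor_poly (r - wt i) (\<lambda>y. X i y $ j) x0 x)"

definition max_det ::
    "nat \<Rightarrow> nat \<Rightarrow> (nat \<Rightarrow> real ^ 'p \<Rightarrow> real ^ 'p) \<Rightarrow> real ^ 'p \<Rightarrow> real" where
  "max_det n r X x =
     Max ((\<lambda>\<I> :: 'p \<Rightarrow> nat list. \<bar>det (\<chi> k. iter_bracket X (\<I> k) x)\<bar>) `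
            {\<I>. \<forall>k. \<I> k \<in> multiindices n r})"

text \<open>The quantities (other than the two domains) on which constants may depend: \<open>K\<close> bounds the
  norms of the coefficients, \<open>\<omega>\<close> bounds the moduli of continuity of their derivatives of highest
  order, and \<open>c0\<close> is the lower bound for the determinants. The order of regularity of the
  coefficients of \<open>X i\<close> is \<open>r - wt i\<close>.\<close>

definition controlled_by ::
    "(real ^ 'p) set \<Rightarrow> (real ^ 'p) set \<Rightarrow> nat \<Rightarrow> nat \<Rightarrow> real \<Rightarrow> (real \<Rightarrow> real) \<Rightarrow> real \<Rightarrow>
     (nat \<Rightarrow> real ^ 'p \<Rightarrow> real ^ 'p) \<Rightarrow> bool" where
  "controlled_by \<Omega> \<Omega>' n r K \<omega> c0 X \<longleftrightarrow>
     (\<forall>i\<le>n. \<forall>j. Ck_norm (r - wt i) \<Omega> (\<lambda>x. X i x $ j) \<le> K) \<and>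
     (\<forall>i\<le>n. \<forall>j. \<forall>\<alpha>. length \<alpha> = r - wt i \<longrightarrow>
        (\<forall>t>0. continuity_modulus \<Omega> (pderivs \<alpha> (\<lambda>x. X i x $ j)) t \<le> \<omega> t)) \<and>
     c0 \<le> (INF x\<in>\<Omega>'. max_det n r X x)"


section \<open>Distances and balls\<close>

definition abs_continuous_on :: "real set \<Rightarrow> (real \<Rightarrow> 'a::real_normed_vector) \<Rightarrow> bool" where
  "abs_continuous_on S f \<longleftrightarrow>
     (\<forall>\<epsilon>>0. \<exists>\<eta>>0. \<forall>D T. D division_of T \<and> T \<subseteq> S \<and> (\<Sum>k\<in>D. Sup k - Inf k) < \<eta> \<longrightarrow>
        (\<Sum>k\<in>D. norm (f (Sup k) - f (Inf k))) < \<epsilon>)"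

definition curve_class ::
    "(real ^ 'p) set \<Rightarrow> nat \<Rightarrow> nat \<Rightarrow> (nat \<Rightarrow> real ^ 'p \<Rightarrow> real ^ 'p) \<Rightarrow> real \<Rightarrow>
     (real \<Rightarrow> real ^ 'p) set" where
  "curve_class \<Omega> n r Y \<delta> =
     {\<phi>. \<phi> ` {0..1} \<subseteq> \<Omega> \<and> abs_continuous_on {0..1} \<phi> \<and>
        (\<exists>a :: nat list \<Rightarrow> real \<Rightarrow> real.
           (\<forall>I\<in>multiindices n r. a I \<in> borel_measurable (lebesgue_on {0..1}) \<and>
              (\<forall>t\<in>{0..1}. \<bar>a I t\<bar> \<le> \<delta> ^ weight I)) \<and>
           (AE t in lebesgue_on {0..1}.
              (\<phi> has_vector_derivative
                 (\<Sum>I\<in>multiindices n r. a I t *\<^sub>R iter_bracket Y I (\<phi> t))) (at t within {0..1})))}"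

definition cc_dist ::
    "(real ^ 'p) set \<Rightarrow> nat \<Rightarrow> nat \<Rightarrow> (nat \<Rightarrow> real ^ 'p \<Rightarrow> real ^ 'p) \<Rightarrow>
     real ^ 'p \<Rightarrow> real ^ 'p \<Rightarrow> ereal" where
  "cc_dist \<Omega> n r Y x y =
     Inf {ereal \<delta> | \<delta>. \<delta> > 0 \<and> (\<exists>\<phi>\<in>curve_class \<Omega> n r Y \<delta>. \<phi> 0 = x \<and> \<phi> 1 = y)}"

definition cc_ball ::
    "(real ^ 'p) set \<Rightarrow> nat \<Rightarrow> nat \<Rightarrow> (nat \<Rightarrow> real ^ 'p \<Rightarrow> real ^ 'p) \<Rightarrow>
     real ^ 'p \<Rightarrow> real \<Rightarrow> (real ^ 'p) set" where
  "cc_ball \<Omega> n r Y x \<rho> = {y \<in> \<Omega>. cc_dist \<Omega> n r Y x y < ereal \<rho>}"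

text \<open>The sums and maxima over \<^const>\<open>multiindices\<close> above range over a finite nonempty set.\<close>

lemma length_le_weight: "length I \<le> weight I"
  by (induction I) (auto simp: weight_def wt_def)

lemma finite_multiindices: "finite (multiindices n r)"
proof (rule finite_subset)
  show "multiindices n r \<subseteq> {I. set I \<subseteq> {0..n} \<and> length I \<le> r}"
    using length_le_weight by (auto simp: multiindices_def intro: order_trans)
  show "finite {I. set I \<subseteq> {0..n} \<and> length I \<le> r}"
    by (rule finite_lists_length_le) simp
qed

lemma multiindices_nonempty: "r \<ge> 2 \<Longrightarrow> multiindices n r \<noteq> {}"
proof -
  assume "r \<ge> 2"
  then have "[0] \<in> multiindices n r"
    by (simp add: multiindices_def weight_def wt_def)
  then show ?thesis by blast
qed

end

theory Submission
  imports Defs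
begin

text \<open>The same curve \<open>\<phi>\<close> is admissible for both systems, up to enlarging \<open>\<delta>\<close> by a constant factor.
  The coefficients of $X_i$ and $S_i^{x_0}$ agree at \<open>x\<^sub>0\<close> to order \<open>r - p\<^sub>i\<close>, and this contact
  passes to commutators: $X_{[I]} - S_{[I]}$ is small compared with $|x - x_0|^{r-|I|}$ on a ball
  around \<open>x\<^sub>0\<close> of uniform radius. An admissible curve from \<open>x\<^sub>0\<close> stays within $O(\delta)$ of
  \<open>x\<^sub>0\<close>, and there the commutators of either system contain a basis of the space which is a small
  perturbation of a basis $(X_{[I_k]})_{x_0}$ of determinant at least $c_0$. By Cramer's rule the
  error $X_{[I]} - S_{[I]}$ along the curve is a combination of these basis fields with measurable
  coefficients $O(\delta^{r-|I|})$; multiplied by $a_I = O(\delta^{|I|})$ they become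
  $O(\delta^r)$, which is admissible since all weights are at most \<open>r\<close>.\<close>


section \<open>Flat functions\<close>

text \<open>The obstacle is that a commutator $X_{[I]}$ of weight r is merely continuous, so that no
  Lipschitz bound for it is at hand. Two devices replace it. Contact is measured with a small factor
  \<eta>, taken from the moduli of continuity, in front of $|x - x_0|^{r-|I|}$; for |I| = r this
  factor is the only smallness left. And the oscillation of $X_{[I]}$ near \<open>x0\<close> is read
  off from $S_{[I]}$, which is polynomial and has derivative bounds uniform in \<open>x0\<close>.
  The weights keep the accounts: a bracket costs one derivative and one order of contact, while it
  adds at least one to the weight, so a commutator of weight w retains r - w of both. Uniformity in
  X and \<open>x0\<close> rests on the order of the choices: a bound \<open>B\<close> for all
  commutators, then a tolerance that depends on \<open>B\<close> and \<open>c0\<close> by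
  compactness of a ball of matrices, then a radius \<open>R\<close> for that tolerance. Hence the
  lemmas put their constants in front of the quantifiers over sets and fields. Both systems are
  close to the same matrix at \<open>x0\<close>, so either one may be the target, and one factor D
  yields $c_2 = D$ and $c_1 = 1/D$.\<close>

text \<open>The partial derivatives of \<open>f\<close> of order \<open>m \<le> k\<close> are continuous and bounded by
  \<open>M * d x ^ (e - m)\<close>, with truncated subtraction: \<open>e = 0\<close> is a plain $C^k$ bound, while
  \<open>e = k\<close> with \<open>d\<close> the distance to \<open>x\<^sub>0\<close> expresses contact of order \<open>k\<close> with 0 at \<open>x\<^sub>0\<close>.\<close>

fun Ck_flat ::
    "(real ^ 'p \<Rightarrow> real) \<Rightarrow> (real ^ 'p) set \<Rightarrow> nat \<Rightarrow> real \<Rightarrow> nat \<Rightarrow> (real ^ 'p \<Rightarrow> real) \<Rightarrow> bool" where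
  "Ck_flat d U e M 0 f \<longleftrightarrow> continuous_on U f \<and> (\<forall>x\<in>U. \<bar>f x\<bar> \<le> M * d x ^ e)"
| "Ck_flat d U e M (Suc k) f \<longleftrightarrow>
     (\<forall>x\<in>U. f differentiable (at x)) \<and> (\<forall>x\<in>U. \<bar>f x\<bar> \<le> M * d x ^ e) \<and>
     (\<forall>j. Ck_flat d U (e - 1) M k (pderiv1 j f))"

lemma continuous_on_if_differentiable: "(\<And>x. x \<in> U \<Longrightarrow> f differentiable (at x)) \<Longrightarrow> continuous_on U f"
  by (meson continuous_at_imp_continuous_on differentiable_imp_continuous_within)

lemma pderiv1_unique:
  "(f has_derivative f') (at x) \<Longrightarrow> pderiv1 j f x = f' (axis j 1)"
  unfolding pderiv1_def by (metis frechet_derivative_at)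

text \<open>\<open>frechet_derivative\<close> is a choice among all derivatives, and functions that
  agree near \<open>x\<close> have the same ones; so this covers points of non-differentiability as
  well.\<close>

lemma pderiv1_cong:
  assumes "open U" "x \<in> U" "\<And>y. y \<in> U \<Longrightarrow> f y = g y"
  shows "pderiv1 j f x = pderiv1 j g x"
proof -
  have "(f has_derivative f') (at x) \<longleftrightarrow> (g has_derivative f') (at x)" for f'
    using assms has_derivative_transform_within_open[of _ f' x UNIV U]
    by (metis)
  then show ?thesis unfolding pderiv1_def frechet_derivative_def by simp
qed

lemma differentiable_cong_open:
  assumes "open U" "x \<in> U" "\<And>y. y \<in> U \<Longrightarrow> f y = g y" "f differentiable (at x)"
  shows "g differentiable (at x)"
  using assms has_derivative_transform_within_open[of f _ x UNIV U g]
  unfolding differentiable_def by metis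

lemma pderiv1_add:
  "f differentiable (at x) \<Longrightarrow> g differentiable (at x) \<Longrightarrow>
   pderiv1 j (\<lambda>x. f x + g x) x = pderiv1 j f x + pderiv1 j g x"
  unfolding frechet_derivative_works
  by (drule (1) has_derivative_add, drule pderiv1_unique) (simp add: pderiv1_def)

lemma pderiv1_diff:
  "f differentiable (at x) \<Longrightarrow> g differentiable (at x) \<Longrightarrow>
   pderiv1 j (\<lambda>x. f x - g x) x = pderiv1 j f x - pderiv1 j g x"
  unfolding frechet_derivative_works
  by (drule (1) has_derivative_diff, drule pderiv1_unique) (simp add: pderiv1_def)

lemma pderiv1_mult:
  fixes f g :: "real ^ 'p \<Rightarrow> real"
  shows "f differentiable (at x) \<Longrightarrow> g differentiable (at x) \<Longrightarrow>
   pderiv1 j (\<lambda>x. f x * g x) x = pderiv1 j f x * g x + f x * pderiv1 j g x"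
  unfolding frechet_derivative_works
  by (drule (1) has_derivative_mult, drule pderiv1_unique[where j = j]) (simp add: pderiv1_def)

lemma pderiv1_const [simp]: "pderiv1 j (\<lambda>x. c) x = 0"
  by (metis has_derivative_const pderiv1_unique)

lemma Ck_flat_bound: "Ck_flat d U e M k f \<Longrightarrow> x \<in> U \<Longrightarrow> \<bar>f x\<bar> \<le> M * d x ^ e"
  by (cases k) auto

lemma Ck_flat_continuous: "Ck_flat d U e M k f \<Longrightarrow> continuous_on U f"
  by (cases k) (auto intro: continuous_on_if_differentiable)

lemma Ck_flat_pderiv1: "Ck_flat d U e M (Suc k) f \<Longrightarrow> Ck_flat d U (e - 1) M k (pderiv1 j f)"
  by simp

lemma Ck_flat_cong:
  assumes "open U" "Ck_flat d U e M k f" "\<And>y. y \<in> U \<Longrightarrow> f y = g y"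
  shows "Ck_flat d U e M k g"
  using assms
proof (induction k arbitrary: e f g)
  case 0
  then show ?case using continuous_on_cong by fastforce
next
  case (Suc k)
  have "Ck_flat d U (e - 1) M k (pderiv1 j g)" for j
    using Suc.IH[of "e-1" "pderiv1 j f" "pderiv1 j g"] Suc.prems pderiv1_cong by (metis Ck_flat_pderiv1)
  moreover have "g differentiable (at x)" if "x \<in> U" for x
    using differentiable_cong_open that Suc.prems(1,2,3) by (metis Ck_flat.simps(2))
  moreover have "\<bar>g x\<bar> \<le> M * d x ^ e" if "x \<in> U" for x
    using Suc.prems(2,3) that Ck_flat_bound by metis
  ultimately show ?case by simp
qed

lemma Ck_flat_subset:
  assumes "Ck_flat d U e M k f" "V \<subseteq> U"
  shows "Ck_flat d V e M k f"
  using assms by (induction k arbitrary: e f) (auto intro: continuous_on_subset)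

text \<open>A gauge with values in [0, 1] turns a lower exponent into a weaker bound. The truncated
  subtraction is harmless, because \<open>e' \<le> e\<close> implies
  \<open>e' - 1 \<le> e - 1\<close>.\<close>

lemma Ck_flat_mono:
  assumes "Ck_flat d U e M k f" "M \<le> M'" "0 \<le> M" "e' \<le> e" "k' \<le> k"
    and d: "\<And>x. x \<in> U \<Longrightarrow> 0 \<le> d x \<and> d x \<le> 1"
  shows "Ck_flat d U e' M' k' f"
  using assms(1,4,5)
proof (induction k' arbitrary: e e' f k)
  case bound: 0
  have "M * d x ^ e \<le> M' * d x ^ e'" if "x \<in> U" for x
    using assms(2,3) d[OF that] bound(2) by (intro mult_mono power_decreasing) auto
  then show ?case using bound Ck_flat_bound Ck_flat_continuous by (fastforce intro: order_trans)
next
  case (Suc k')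
  obtain k0 where k: "k = Suc k0" "k' \<le> k0" using Suc.prems(3) by (metis Suc_le_D Suc_le_mono)
  have "M * d x ^ e \<le> M' * d x ^ e'" if "x \<in> U" for x
    using assms(2,3) d[OF that] Suc(3) by (intro mult_mono power_decreasing) auto
  then show ?case using Suc.prems k Suc.IH[of "e - 1" k0 _ "e' - 1"]
    by (fastforce intro: order_trans diff_le_mono)
qed

lemma Ck_flat_add:
  assumes "open U" "Ck_flat d U e M k f" "Ck_flat d U e N k g"
  shows "Ck_flat d U e (M + N) k (\<lambda>x. f x + g x)"
  using assms(2,3)
proof (induction k arbitrary: e f g)
  case 0
  then show ?case by (fastforce intro: continuous_on_add simp: algebra_simps)
next
  case (Suc k)
  have "Ck_flat d U (e - 1) (M + N) k (pderiv1 j (\<lambda>x. f x + g x))" for j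
    by (rule Ck_flat_cong[OF \<open>open U\<close> Suc.IH[of "e - 1" "pderiv1 j f" "pderiv1 j g"]])
      (use Suc.prems in \<open>auto simp: pderiv1_add\<close>)
  then show ?case using Suc.prems by (fastforce intro: differentiable_add simp: algebra_simps)
qed

lemma Ck_flat_const:
  fixes U :: "(real ^ 'p) set"
  assumes "\<bar>c\<bar> \<le> M"
  shows "Ck_flat d U 0 M k (\<lambda>x. c)"
proof -
  have "0 \<le> M" using assms by linarith
  have "Ck_flat d U 0 M k (\<lambda>x. c)" if "\<bar>c\<bar> \<le> M" for c
    using that
  proof (induction k arbitrary: c)
    case (Suc k)
    have "pderiv1 j (\<lambda>x. c) = (\<lambda>x. 0)" for j :: 'p by auto
    then show ?case using Suc \<open>0 \<le> M\<close> by auto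
  qed auto
  then show ?thesis using assms .
qed

lemma Ck_flat_zero:
  fixes U :: "(real ^ 'p) set"
  assumes "0 \<le> M" "\<And>x. x \<in> U \<Longrightarrow> 0 \<le> d x"
  shows "Ck_flat d U e M k (\<lambda>x. 0)"
proof (induction k arbitrary: e)
  case (Suc k)
  have "pderiv1 j (\<lambda>x. 0) = (\<lambda>x. 0)" for j :: 'p by auto
  then show ?case using Suc assms by auto
qed (use assms in auto)

text \<open>The product rule yields two products per differentiation, hence the factor
  \<open>2 ^ k\<close>. A derivative that falls on \<open>f\<close> leaves the exponent
  \<open>e\<close> alone, one that falls on \<open>g\<close> lowers it by one; both stay within the
  exponent \<open>e - 1\<close> demanded of first derivatives.\<close>

lemma Ck_flat_mult:
  assumes "open U" and d: "\<And>x. x \<in> U \<Longrightarrow> 0 \<le> d x \<and> d x \<le> 1" and "0 \<le> M" "0 \<le> N"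
    and "Ck_flat d U 0 M k f" "Ck_flat d U e N k g"
  shows "Ck_flat d U e (2 ^ k * (M * N)) k (\<lambda>x. f x * g x)"
  using assms(5,6)
proof (induction k arbitrary: e f g)
  case 0
  have "\<bar>f x * g x\<bar> \<le> M * N * d x ^ e" if "x \<in> U" for x
    using 0 that mult_mono[of "\<bar>f x\<bar>" M "\<bar>g x\<bar>" "N * d x ^ e"] \<open>0 \<le> M\<close> by (auto simp: abs_mult mult_ac)
  then show ?case using 0 by (auto intro: continuous_on_mult)
next
  case (Suc k)
  have f: "Ck_flat d U 0 M k f" and g: "Ck_flat d U (e - 1) N k g"
    using Ck_flat_mono[OF Suc.prems(1) order_refl \<open>0 \<le> M\<close>] Ck_flat_mono[OF Suc.prems(2) order_refl \<open>0 \<le>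
      N\<close>]
      d by auto
  have "Ck_flat d U (e - 1)
    (2 ^ k * (M * N) + 2 ^ k * (M * N)) k (\<lambda>x. pderiv1 j f x * g x + f x * pderiv1 j g x)"
    for j
    by (rule Ck_flat_add[OF \<open>open U\<close> Suc.IH Suc.IH])
      (use Suc.prems f g in auto)
  then have "Ck_flat d U (e - 1) (2 ^ Suc k * (M * N)) k (pderiv1 j (\<lambda>x. f x * g x))" for j
    by (intro Ck_flat_cong[OF \<open>open U\<close>, where g = "pderiv1 j (\<lambda>x. f x * g x)"])
      (use Suc.prems in \<open>auto simp: pderiv1_mult algebra_simps\<close>)
  moreover have "\<bar>f x * g x\<bar> \<le> 2 ^ Suc k * (M * N) * d x ^ e" if "x \<in> U" for x
  proof -
    have "\<bar>f x * g x\<bar> \<le> M * (N * d x ^ e)"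
      using Suc.prems that mult_mono[of "\<bar>f x\<bar>" M "\<bar>g x\<bar>" "N * d x ^ e"] \<open>0 \<le> M\<close> by (auto simp: abs_mult)
    also have "\<dots> \<le> 2 ^ Suc k * (M * (N * d x ^ e))"
      using d[OF that] \<open>0 \<le> M\<close> \<open>0 \<le> N\<close> mult_right_mono[of 1 "2 ^ Suc k" "M * (N * d x ^ e)"]
        one_le_power[of "2::real" "Suc k"] by simp
    finally show ?thesis by (simp add: mult_ac)
  qed
  ultimately show ?case using Suc.prems by (auto intro: differentiable_mult)
qed

lemma Ck_flat_scale:
  assumes "open U" "\<And>x. x \<in> U \<Longrightarrow> 0 \<le> d x" "\<bar>c\<bar> \<le> L" "0 \<le> M" "Ck_flat d U e M k f"
  shows "Ck_flat d U e (L * M) k (\<lambda>x. c * f x)"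
  using assms(5)
proof (induction k arbitrary: e f)
  case 0
  have "\<bar>c * f x\<bar> \<le> L * (M * d x ^ e)" if "x \<in> U" for x
    using 0 that assms(2,3) unfolding abs_mult by (intro mult_mono) auto
  then show ?case using 0 by (auto intro: continuous_on_mult simp: mult_ac)
next
  case (Suc k)
  have "\<bar>c * f x\<bar> \<le> L * (M * d x ^ e)" if "x \<in> U" for x
    using Suc.prems that assms(2,3) unfolding abs_mult by (intro mult_mono) auto
  moreover have "Ck_flat d U (e - 1) (L * M) k (pderiv1 j (\<lambda>x. c * f x))" for j
    by (rule Ck_flat_cong[OF \<open>open U\<close> Suc.IH[of "e - 1" "pderiv1 j f"]])
      (use Suc.prems in \<open>auto simp: pderiv1_mult\<close>)
  ultimately show ?case using Suc.prems by (auto intro: differentiable_mult simp: mult_ac)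
qed

lemma Ck_flat_diff:
  assumes "open U" "\<And>x. x \<in> U \<Longrightarrow> 0 \<le> d x" "0 \<le> N" "Ck_flat d U e M k f" "Ck_flat d U e N k g"
  shows "Ck_flat d U e (M + N) k (\<lambda>x. f x - g x)"
  using Ck_flat_add[OF assms(1,4) Ck_flat_scale[OF assms(1,2) _ assms(3,5), of "-1" 1]] by simp

lemma Ck_flat_sum:
  assumes "open U" "\<And>x. x \<in> U \<Longrightarrow> 0 \<le> d x" "0 \<le> M" "finite A"
    and "\<And>i. i \<in> A \<Longrightarrow> Ck_flat d U e M k (f i)"
  shows "Ck_flat d U e (real (card A) * M) k (\<lambda>x. \<Sum>i\<in>A. f i x)"
  using assms(4,5)
proof (induction A rule: finite_induct)
  case empty
  then show ?case using Ck_flat_zero[of 0 U d] assms(2) by simp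
next
  case (insert i A)
  then have "Ck_flat d U e (M + real (card A) * M) k (\<lambda>x. f i x + (\<Sum>i\<in>A. f i x))"
    by (intro Ck_flat_add[OF assms(1)]) auto
  then show ?case using insert by (simp add: algebra_simps)
qed

section \<open>Symmetry of mixed partial derivatives\<close>

lemma has_real_derivative_along_axis:
  fixes f :: "real ^ 'p \<Rightarrow> real"
  assumes "f differentiable (at (a + u *\<^sub>R axis j 1))"
  shows "((\<lambda>u. f (a + u *\<^sub>R axis j 1)) has_real_derivative pderiv1 j f (a + u *\<^sub>R axis j 1)) (at u)"
proof -
  have f: "(f has_derivative frechet_derivative f (at (a + u *\<^sub>R axis j 1))) (at (a + u *\<^sub>R axis j 1))"
    using assms frechet_derivative_works by blast
  have "((\<lambda>u. a + u *\<^sub>R axis j 1) has_derivative (\<lambda>t. t *\<^sub>R axis j 1)) (at u)"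
    by (auto intro!: derivative_eq_intros)
  from diff_chain_at[OF this f]
  have "((\<lambda>u. f (a + u *\<^sub>R axis j 1)) has_derivative
     (\<lambda>t. t * pderiv1 j f (a + u *\<^sub>R axis j 1))) (at u)"
    using linear_cmul[OF has_derivative_linear[OF f]] by (simp add: o_def pderiv1_def)
  then show ?thesis by (simp add: has_field_derivative_def mult.commute[of _ "pderiv1 _ _ _"])
qed

text \<open>The mean value theorem is applied twice: in direction \<open>i\<close> to the difference
  of two values of \<open>f\<close> in direction \<open>j\<close>, then in direction
  \<open>j\<close> to \<open>pderiv1 i f\<close>.\<close>

lemma second_difference_mvt:
  fixes f :: "real ^ 'p \<Rightarrow> real"
  assumes "h > 0" and box: "\<And>s t. 0 \<le> s \<Longrightarrow> s \<le> h \<Longrightarrow> 0 \<le> t \<Longrightarrow> t \<le> h \<Longrightarrow>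
    x + s *\<^sub>R axis i 1 + t *\<^sub>R axis j 1 \<in> U"
    and "\<And>y. y \<in> U \<Longrightarrow> f differentiable (at y)" "\<And>y. y \<in> U \<Longrightarrow> pderiv1 i f differentiable (at y)"
  shows "\<exists>s t. 0 < s \<and> s < h \<and> 0 < t \<and> t < h \<and>
    f (x + h *\<^sub>R axis i 1 + h *\<^sub>R axis j 1) - f (x + h *\<^sub>R axis i 1) - f (x + h *\<^sub>R axis j 1) + f x =
    h * h * pderiv1 j (pderiv1 i f) (x + s *\<^sub>R axis i 1 + t *\<^sub>R axis j 1)"
proof -
  let ?g = "\<lambda>s. f (x + h *\<^sub>R axis j 1 + s *\<^sub>R axis i 1) - f (x + s *\<^sub>R axis i 1)"
  have "((\<lambda>s. f (x + h *\<^sub>R axis j 1 + s *\<^sub>R axis i 1) - f (x + s *\<^sub>R axis i 1)) has_real_derivative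
     pderiv1 i f (x + h *\<^sub>R axis j 1 + s *\<^sub>R axis i 1) - pderiv1 i f (x + s *\<^sub>R axis i 1)) (at s)"
    if "0 \<le> s" "s \<le> h" for s
    using box[of s h] box[of s 0] that \<open>h > 0\<close> assms(3)
    by (intro DERIV_diff has_real_derivative_along_axis) (auto simp: add_ac)
  from MVT2[OF \<open>h > 0\<close> this] obtain s where s: "0 < s" "s < h"
    "?g h - ?g 0 = h * (pderiv1 i f (x + h *\<^sub>R axis j 1 + s *\<^sub>R axis i 1) - pderiv1 i f (x + s *\<^sub>R axis i 1))"
    by auto
  have "((\<lambda>t. pderiv1 i f (x + s *\<^sub>R axis i 1 + t *\<^sub>R axis j 1)) has_real_derivative
     pderiv1 j (pderiv1 i f) (x + s *\<^sub>R axis i 1 + t *\<^sub>R axis j 1)) (at t)"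
    if "0 \<le> t" "t \<le> h" for t
    using box[of s t] that s assms(4)
    by (intro DERIV_diff has_real_derivative_along_axis) (auto simp: add_ac)
  from MVT2[OF \<open>h > 0\<close> this] obtain t where t: "0 < t" "t < h"
    "pderiv1 i f (x + s *\<^sub>R axis i 1 + h *\<^sub>R axis j 1) - pderiv1 i f (x + s *\<^sub>R axis i 1)
     = h * pderiv1 j (pderiv1 i f) (x + s *\<^sub>R axis i 1 + t *\<^sub>R axis j 1)"
    by auto
  have "x + h *\<^sub>R axis j 1 + s *\<^sub>R axis i 1 = x + s *\<^sub>R axis i 1 + h *\<^sub>R axis j 1"
    "x + h *\<^sub>R axis j 1 + h *\<^sub>R axis i 1 = x + h *\<^sub>R axis i 1 + h *\<^sub>R axis j 1" by auto
  with s t show ?thesis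
    by (intro exI[of _ s] exI[of _ t]) (simp add: algebra_simps)
qed

text \<open>The second difference is symmetric in \<open>i\<close> and \<open>j\<close>, so on every
  small square some value of one mixed derivative equals some value of the other. Continuity at
  \<open>x\<close> then excludes a gap between the two.\<close>

lemma pderiv1_commute:
  fixes f :: "real ^ 'p \<Rightarrow> real"
  assumes "open U" "x \<in> U" "Ck_flat d U e M (Suc (Suc k)) f"
  shows "pderiv1 i (pderiv1 j f) x = pderiv1 j (pderiv1 i f) x"
proof (rule ccontr)
  let ?D = "\<lambda>i j. pderiv1 i (pderiv1 j f)"
  assume ne: "?D i j x \<noteq> ?D j i x"
  define \<epsilon> where "\<epsilon> = \<bar>?D i j x - ?D j i x\<bar> / 2"
  have "\<epsilon> > 0" using ne by (simp add: \<epsilon>_def)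
  have cont: "isCont (?D a b) x" for a b
  proof -
    have "Ck_flat d U (e - 1 - 1) M k (?D a b)" using assms(3) by simp
    then show ?thesis using assms(1,2) Ck_flat_continuous continuous_on_eq_continuous_at by blast
  qed
  obtain \<eta>1 where \<eta>1: "\<eta>1 > 0" "\<And>y. dist y x < \<eta>1 \<Longrightarrow> \<bar>?D i j y - ?D i j x\<bar> < \<epsilon>"
    using cont \<open>\<epsilon> > 0\<close> unfolding continuous_at_eps_delta dist_real_def by metis
  obtain \<eta>2 where \<eta>2: "\<eta>2 > 0" "\<And>y. dist y x < \<eta>2 \<Longrightarrow> \<bar>?D j i y - ?D j i x\<bar> < \<epsilon>"
    using cont \<open>\<epsilon> > 0\<close> unfolding continuous_at_eps_delta dist_real_def by metis
  obtain \<eta>3 where \<eta>3: "\<eta>3 > 0" "ball x \<eta>3 \<subseteq> U" using assms(1,2) openE by metis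
  define \<eta> where "\<eta> = min \<eta>1 (min \<eta>2 \<eta>3)"
  have \<eta>: "\<eta> > 0" "\<eta> \<le> \<eta>1" "\<eta> \<le> \<eta>2" "\<eta> \<le> \<eta>3" using \<eta>1 \<eta>2 \<eta>3 by (auto simp: \<eta>_def)
  define h where "h = \<eta> / 3"
  have h: "h > 0" "2 * h < \<eta>" using \<eta> by (auto simp: h_def)
  have near: "dist (x + s *\<^sub>R axis a 1 + t *\<^sub>R axis b 1) x < \<eta>" if "0 \<le> s" "s \<le> h" "0 \<le> t" "t \<le> h"
    for a b :: 'p and s t
  proof -
    have "dist (x + s *\<^sub>R axis a 1 + t *\<^sub>R axis b 1) x \<le>
      norm (s *\<^sub>R axis a 1 :: real ^ 'p) + norm (t *\<^sub>R axis b 1 :: real ^ 'p)"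
      by (metis add_diff_cancel_left' dist_norm norm_triangle_ineq add.assoc)
    then show ?thesis using that h by (simp add: norm_axis_1)
  qed
  have U: "x + s *\<^sub>R axis a 1 + t *\<^sub>R axis b 1 \<in> U" if "0 \<le> s" "s \<le> h" "0 \<le> t" "t \<le> h"
    for a b :: 'p and s t
    using near[OF that, of a b] \<eta> \<eta>3 by (auto simp: dist_commute subset_eq)
  have df: "f differentiable (at y)" "pderiv1 a f differentiable (at y)" if "y \<in> U" for y a
    using assms that by auto
  obtain s t where st: "0 < s" "s < h" "0 < t" "t < h"
    "f (x + h *\<^sub>R axis i 1 + h *\<^sub>R axis j 1) - f (x + h *\<^sub>R axis i 1) - f (x + h *\<^sub>R axis j 1) + f x =
      h * h * ?D j i (x + s *\<^sub>R axis i 1 + t *\<^sub>R axis j 1)"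
    using second_difference_mvt[of h x i j U f] h U df by blast
  obtain s' t' where st': "0 < s'" "s' < h" "0 < t'" "t' < h"
    "f (x + h *\<^sub>R axis j 1 + h *\<^sub>R axis i 1) - f (x + h *\<^sub>R axis j 1) - f (x + h *\<^sub>R axis i 1) + f x =
      h * h * ?D i j (x + s' *\<^sub>R axis j 1 + t' *\<^sub>R axis i 1)"
    using second_difference_mvt[of h x j i U f] h U df by blast
  have swap: "x + h *\<^sub>R axis j 1 + h *\<^sub>R axis i 1 = x + h *\<^sub>R axis i 1 + h *\<^sub>R axis j 1" by simp
  have "h * h * ?D j i (x + s *\<^sub>R axis i 1 + t *\<^sub>R axis j 1)
     = h * h * ?D i j (x + s' *\<^sub>R axis j 1 + t' *\<^sub>R axis i 1)"
    using st(5) st'(5)[unfolded swap] by linarith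
  then have "?D j i (x + s *\<^sub>R axis i 1 + t *\<^sub>R axis j 1) = ?D i j (x + s' *\<^sub>R axis j 1 + t' *\<^sub>R axis i 1)"
    using h by simp
  moreover have "\<bar>?D j i (x + s *\<^sub>R axis i 1 + t *\<^sub>R axis j 1) - ?D j i x\<bar> < \<epsilon>"
    using \<eta>2(2) near[of s t i j] st \<eta> by force
  moreover have "\<bar>?D i j (x + s' *\<^sub>R axis j 1 + t' *\<^sub>R axis i 1) - ?D i j x\<bar> < \<epsilon>"
    using \<eta>1(2) near[of s' t' j i] st' \<eta> by force
  ultimately show False unfolding \<epsilon>_def by (smt (verit) field_sum_of_halves)
qed

section \<open>Contact of commutators\<close>

text \<open>The bracket is bilinear in the fields and their first derivatives, so replacing one
  factor at a time leaves products that are linear in the error. The error may be differentiated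
  once, which costs one order of contact: \<open>e \<le> e' - 1\<close>. The constant counts
  \<open>CARD('p)\<close> summands of four products, each with the factor \<open>2 ^ k\<close> of
  the product rule.\<close>

lemma Ck_flat_lie_bracket_diff:
  fixes X Z S W :: "real ^ 'p \<Rightarrow> real ^ 'p"
  assumes "open U" and d: "\<And>x. x \<in> U \<Longrightarrow> 0 \<le> d x \<and> d x \<le> 1" and "0 \<le> M" "0 \<le> \<eta>" "e \<le> e' - 1"
    and X: "\<And>j. Ck_flat d U 0 M (Suc k) (\<lambda>x. X x $ j)" and S: "\<And>j. Ck_flat d U 0 M (Suc k) (\<lambda>x. S x $ j)"
    and Z: "\<And>j. Ck_flat d U 0 M (Suc k) (\<lambda>x. Z x $ j)" and W: "\<And>j. Ck_flat d U 0 M (Suc k) (\<lambda>x. W x $ j)"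
    and XS: "\<And>j. Ck_flat d U e' \<eta> (Suc k) (\<lambda>x. X x $ j - S x $ j)"
    and ZW: "\<And>j. Ck_flat d U e' \<eta> (Suc k) (\<lambda>x. Z x $ j - W x $ j)"
  shows "Ck_flat d U e (real CARD('p) * (4 * 2 ^ k * M) * \<eta>) k
    (\<lambda>x. lie_bracket X Z x $ j - lie_bracket S W x $ j)"
proof -
  let ?N = "2 ^ k * (M * \<eta>)"
  have N: "0 \<le> ?N" using \<open>0 \<le> M\<close> \<open>0 \<le> \<eta>\<close> by simp
  have low: "Ck_flat d U 0 M k f" if "Ck_flat d U 0 M (Suc k) f" for f
    using Ck_flat_mono[OF that order_refl \<open>0 \<le> M\<close>] d by simp
  have low': "Ck_flat d U e \<eta> k f" if "Ck_flat d U e' \<eta> (Suc k) f" for f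
    using Ck_flat_mono[OF that order_refl \<open>0 \<le> \<eta>\<close>] d \<open>e \<le> e' - 1\<close> by simp
  have der: "Ck_flat d U 0 M k (pderiv1 i f)" if "Ck_flat d U 0 M (Suc k) f" for f i
    using that by simp
  have der': "Ck_flat d U e \<eta> k (pderiv1 i f)" if "Ck_flat d U e' \<eta> (Suc k) f" for f i
    using Ck_flat_mono[OF Ck_flat_pderiv1[OF that] order_refl \<open>0 \<le> \<eta>\<close>] d \<open>e \<le> e' - 1\<close> by simp
  have mult: "Ck_flat d U e ?N k (\<lambda>x. f x * g x)" if "Ck_flat d U 0 M k f" "Ck_flat d U e \<eta> k g" for f g
    using Ck_flat_mult[OF assms(1) d \<open>0 \<le> M\<close> \<open>0 \<le> \<eta>\<close> that] by blast
  \<comment> \<open>Each product has exactly one factor that is a difference of the two systems; the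
    other one is bounded by \<open>M\<close>.\<close>
  let ?t = "\<lambda>i x. (pderiv1 i (\<lambda>x. Z x $ j) x * (X x $ i - S x $ i)
     + S x $ i * pderiv1 i (\<lambda>x. Z x $ j - W x $ j) x)
     - (pderiv1 i (\<lambda>x. X x $ j) x * (Z x $ i - W x $ i)
     + W x $ i * pderiv1 i (\<lambda>x. X x $ j - S x $ j) x)"
  have "Ck_flat d U e ((?N + ?N) + (?N + ?N)) k (?t i)" for i
  proof (intro Ck_flat_diff Ck_flat_add assms(1))
    show "Ck_flat d U e ?N k (\<lambda>x. pderiv1 i (\<lambda>x. Z x $ j) x * (X x $ i - S x $ i))"
      by (intro mult der low' Z XS)
    show "Ck_flat d U e ?N k (\<lambda>x. S x $ i * pderiv1 i (\<lambda>x. Z x $ j - W x $ j) x)"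
      by (intro mult low der' S ZW)
    show "Ck_flat d U e ?N k (\<lambda>x. pderiv1 i (\<lambda>x. X x $ j) x * (Z x $ i - W x $ i))"
      by (intro mult der low' X ZW)
    show "Ck_flat d U e ?N k (\<lambda>x. W x $ i * pderiv1 i (\<lambda>x. X x $ j - S x $ j) x)"
      by (intro mult low der' W XS)
  qed (use d N \<open>0 \<le> M\<close> \<open>0 \<le> \<eta>\<close> in auto)
  then have "Ck_flat d U e (real CARD('p) * ((?N + ?N) + (?N + ?N))) k (\<lambda>x. \<Sum>i\<in>UNIV. ?t i x)"
    using d add_nonneg_nonneg[OF add_nonneg_nonneg[OF N N] add_nonneg_nonneg[OF N N]]
    by (intro Ck_flat_sum assms(1)) simp_all
  then have "Ck_flat d U e (real CARD('p) * ((?N + ?N) + (?N + ?N))) k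
      (\<lambda>x. lie_bracket X Z x $ j - lie_bracket S W x $ j)"
  proof (rule Ck_flat_cong[OF assms(1)])
    fix x assume "x \<in> U"
    then have "pderiv1 i (\<lambda>x. Z x $ j - W x $ j) x = pderiv1 i (\<lambda>x. Z x $ j) x - pderiv1 i (\<lambda>x. W x $ j) x"
      "pderiv1 i (\<lambda>x. X x $ j - S x $ j) x = pderiv1 i (\<lambda>x. X x $ j) x - pderiv1 i (\<lambda>x. S x $ j) x" for i
      using X S Z W by (auto intro!: pderiv1_diff)
    then have "?t i x = (X x $ i * pderiv1 i (\<lambda>y. Z y $ j) x - Z x $ i * pderiv1 i (\<lambda>y. X y $ j) x)
        - (S x $ i * pderiv1 i (\<lambda>y. W y $ j) x - W x $ i * pderiv1 i (\<lambda>y. S y $ j) x)" for i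
      by (simp only:) (simp add: algebra_simps)
    then show "(\<Sum>i\<in>UNIV. ?t i x) = lie_bracket X Z x $ j - lie_bracket S W x $ j"
      by (simp only: lie_bracket_def vec_lambda_beta sum_subtractf)
  qed
  then show ?thesis by (simp add: algebra_simps)
qed

text \<open>This is the comparison with the zero fields, whose bracket vanishes; the exponent 0
  turns contact into a plain bound, with \<open>M\<close> as error.\<close>

lemma Ck_flat_lie_bracket:
  fixes X Z :: "real ^ 'p \<Rightarrow> real ^ 'p"
  assumes "open U" and d: "\<And>x. x \<in> U \<Longrightarrow> 0 \<le> d x \<and> d x \<le> 1" and "0 \<le> M"
    and "\<And>j. Ck_flat d U 0 M (Suc k) (\<lambda>x. X x $ j)" "\<And>j. Ck_flat d U 0 M (Suc k) (\<lambda>x. Z x $ j)"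
  shows "Ck_flat d U 0 (real CARD('p) * (4 * 2 ^ k * M) * M) k (\<lambda>x. lie_bracket X Z x $ j)"
proof -
  have "lie_bracket (\<lambda>_. 0) (\<lambda>_. 0) x $ j = 0" for x :: "real ^ 'p" by (simp add: lie_bracket_def)
  then show ?thesis
    using Ck_flat_lie_bracket_diff[OF assms(1,2,3,3), where e = 0 and e' = 0 and k = k and X = X
        and S = "\<lambda>_. 0" and Z = Z and W = "\<lambda>_. 0" and j = j] assms(3-5)
      Ck_flat_const[of 0 M d U "Suc k"] by (simp del: Ck_flat.simps(2))
qed

section \<open>Regularity and contact of iterated commutators\<close>

lemma weight_Cons: "weight (i # I) = wt i + weight I"
  by (simp add: weight_def)

lemma wt_pos: "1 \<le> wt i" by (simp add: wt_def)

lemma iter_bracket_Cons: "I \<noteq> [] \<Longrightarrow> iter_bracket Y (i # I) = lie_bracket (Y i) (iter_bracket Y I)"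
  by (cases I) auto

lemma iter_bracket_induct [consumes 1, case_names single Cons]:
  assumes "I \<noteq> []" "\<And>i. P [i]" "\<And>i I. I \<noteq> [] \<Longrightarrow> P I \<Longrightarrow> P (i # I)"
  shows "P I"
  using assms(1) by (induction rule: list_nonempty_induct) (use assms(2,3) in auto)

lemma weight_pos: "I \<noteq> [] \<Longrightarrow> 1 \<le> weight I"
  using length_le_weight[of I] by (cases I) auto

text \<open>The gauge will be the distance to \<open>x0\<close> truncated at 1. The truncation
  admits the whole of \<Omega> as \<open>U\<close>, and on balls of radius at most 1 it changes
  nothing.\<close>

definition unit_gauge :: "(real ^ 'p) set \<Rightarrow> (real ^ 'p \<Rightarrow> real) \<Rightarrow> bool" where
  "unit_gauge U d \<longleftrightarrow> open U \<and> (\<forall>x\<in>U. 0 \<le> d x \<and> d x \<le> 1)"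

lemma unit_gaugeD:
  assumes "unit_gauge U d"
  shows "open U" "x \<in> U \<Longrightarrow> 0 \<le> d x \<and> d x \<le> 1"
  using assms by (auto simp: unit_gauge_def)

text \<open>The order \<open>s\<close> is kept apart from \<open>r\<close> because the polynomial
  fields satisfy the bound with \<open>s = Suc r\<close> too, which makes even their commutators of
  weight \<open>r\<close> differentiable.\<close>

definition fields_bounded ::
    "(real ^ 'p \<Rightarrow> real) \<Rightarrow> (real ^ 'p) set \<Rightarrow> real \<Rightarrow> nat \<Rightarrow> nat set \<Rightarrow> (nat \<Rightarrow> real ^ 'p \<Rightarrow> real ^ 'p) \<Rightarrow> bool" where
  "fields_bounded d U M s A Y \<longleftrightarrow> (\<forall>i\<in>A. \<forall>j. Ck_flat d U 0 M (s - wt i) (\<lambda>x. Y i x $ j))"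

definition fields_close ::
    "(real ^ 'p \<Rightarrow> real) \<Rightarrow> (real ^ 'p) set \<Rightarrow> real \<Rightarrow> nat \<Rightarrow> nat set \<Rightarrow>
     (nat \<Rightarrow> real ^ 'p \<Rightarrow> real ^ 'p) \<Rightarrow> (nat \<Rightarrow> real ^ 'p \<Rightarrow> real ^ 'p) \<Rightarrow> bool" where
  "fields_close d U \<eta> s A Y S \<longleftrightarrow>
     (\<forall>i\<in>A. \<forall>j. Ck_flat d U (s - wt i) \<eta> (s - wt i) (\<lambda>x. Y i x $ j - S i x $ j))"

text \<open>The derivative consumed by each bracket is paid for by the weights: \<open>Y i\<close>
  can spare one since the tail has weight at least 1, and the commutator of the tail can spare one
  since \<open>wt i\<close> is at least 1. The constant is fixed before \<open>U\<close>,
  \<open>d\<close> and \<open>Y\<close>, hence uniform in them.\<close>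

lemma Ck_flat_iter_bracket:
  assumes "I \<noteq> []" "weight I \<le> s" "set I \<subseteq> A" "0 \<le> M"
  shows "\<exists>C\<ge>0. \<forall>U d (Y :: nat \<Rightarrow> real ^ 'p \<Rightarrow> real ^ 'p). unit_gauge U d \<longrightarrow> fields_bounded d U M s A Y \<longrightarrow>
     (\<forall>j. Ck_flat d U 0 C (s - weight I) (\<lambda>x. iter_bracket Y I x $ j))"
  using assms(1-3)
proof (induction rule: iter_bracket_induct)
  case (single i)
  then show ?case using \<open>0 \<le> M\<close> by (auto simp: weight_def fields_bounded_def)
next
  case (Cons i I)
  from Cons obtain C where C: "C \<ge> 0" "\<And>U d (Y :: nat \<Rightarrow> real ^ 'p \<Rightarrow> real ^ 'p) j. unit_gauge U d \<Longrightarrow>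
     fields_bounded d U M s A Y \<Longrightarrow> Ck_flat d U 0 C (s - weight I) (\<lambda>x. iter_bracket Y I x $ j)"
    by (auto simp: weight_Cons)
  let ?k = "s - weight (i # I)" and ?M = "max M C"
  have k: "Suc ?k \<le> s - wt i" "Suc ?k \<le> s - weight I" "i \<in> A"
    using Cons.prems weight_pos[OF Cons.hyps] wt_pos[of i] by (auto simp: weight_Cons)
  have "Ck_flat d U 0 (real CARD('p) * (4 * 2 ^ ?k * ?M) * ?M) ?k (\<lambda>x. iter_bracket Y (i # I) x $ j)"
    if U: "unit_gauge U d" and Y: "fields_bounded d U M s A Y"
    for U d and Y :: "nat \<Rightarrow> real ^ 'p \<Rightarrow> real ^ 'p" and j
    unfolding iter_bracket_Cons[OF Cons.hyps]
  proof (rule Ck_flat_lie_bracket[OF unit_gaugeD[OF U]])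
    have "Ck_flat d U 0 M (s - wt i) (\<lambda>x. Y i x $ j)" for j
      using Y k(3) by (simp add: fields_bounded_def)
    then show "Ck_flat d U 0 ?M (Suc ?k) (\<lambda>x. Y i x $ j)" for j
      by (rule Ck_flat_mono[OF _ max.cobounded1 \<open>0 \<le> M\<close> order_refl k(1) unit_gaugeD(2)[OF U]])
    show "Ck_flat d U 0 ?M (Suc ?k) (\<lambda>x. iter_bracket Y I x $ j)" for j
      by (rule Ck_flat_mono[OF C(2)[OF U Y] max.cobounded2 C(1) order_refl k(2) unit_gaugeD(2)[OF U]])
  qed (use \<open>0 \<le> M\<close> in auto)
  moreover have "0 \<le> real CARD('p) * (4 * 2 ^ ?k * ?M) * ?M" using \<open>0 \<le> M\<close> by simp
  ultimately show ?case by blast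
qed

text \<open>Contact is lost at the same rate as regularity, one order per bracket. The bound is
  linear in \<eta>, so a small error in the coefficients gives a proportionally small error in the
  commutators.\<close>

lemma Ck_flat_iter_bracket_diff:
  assumes "I \<noteq> []" "weight I \<le> s" "set I \<subseteq> A" "0 \<le> M"
  shows "\<exists>C\<ge>0. \<forall>U d \<eta> (Y :: nat \<Rightarrow> real ^ 'p \<Rightarrow> real ^ 'p) S. unit_gauge U d \<longrightarrow> 0 \<le> \<eta> \<longrightarrow>
     fields_bounded d U M s A Y \<longrightarrow> fields_bounded d U M s A S \<longrightarrow> fields_close d U \<eta> s A Y S \<longrightarrow>
     (\<forall>j. Ck_flat d U (s - weight I) (C * \<eta>) (s - weight I)
       (\<lambda>x. iter_bracket Y I x $ j - iter_bracket S I x $ j))"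
  using assms(1-3)
proof (induction rule: iter_bracket_induct)
  case (single i)
  then show ?case by (intro exI[of _ 1]) (simp add: weight_def fields_close_def)
next
  case (Cons i I)
  from Cons obtain D where D: "D \<ge> 0" "\<And>U d \<eta> (Y :: nat \<Rightarrow> real ^ 'p \<Rightarrow> real ^ 'p) S j. unit_gauge U d \<Longrightarrow>
    0 \<le> \<eta> \<Longrightarrow>
     fields_bounded d U M s A Y \<Longrightarrow> fields_bounded d U M s A S \<Longrightarrow> fields_close d U \<eta> s A Y S \<Longrightarrow>
     Ck_flat d U (s - weight I) (D * \<eta>) (s - weight I)
       (\<lambda>x. iter_bracket Y I x $ j - iter_bracket S I x $ j)"
    by (auto simp: weight_Cons)
  have w: "weight I \<le> s" and sub: "set I \<subseteq> A" using Cons.prems by (auto simp: weight_Cons)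
  obtain C where C: "C \<ge> 0" "\<And>U d (Y :: nat \<Rightarrow> real ^ 'p \<Rightarrow> real ^ 'p) j. unit_gauge U d \<Longrightarrow>
     fields_bounded d U M s A Y \<Longrightarrow> Ck_flat d U 0 C (s - weight I) (\<lambda>x. iter_bracket Y I x $ j)"
    using Ck_flat_iter_bracket[OF Cons.hyps w sub \<open>0 \<le> M\<close>, where 'p = 'p] by metis
  \<comment> \<open>One pair of bounds for both entries of the bracket: \<open>?M\<close> for sizes,
    and \<open>?D * \<eta>\<close> for the error \<eta> of the field as well as the error
    \<open>D * \<eta>\<close> of the shorter commutator.\<close>
  let ?k = "s - weight (i # I)" and ?M = "max M C" and ?D = "max 1 D"
  have k: "Suc ?k \<le> s - wt i" "Suc ?k \<le> s - weight I" "i \<in> A"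
    using Cons.prems weight_pos[OF Cons.hyps] wt_pos[of i] by (auto simp: weight_Cons)
  have "Ck_flat d U ?k ((real CARD('p) * (4 * 2 ^ ?k * ?M) * ?D) * \<eta>) ?k
      (\<lambda>x. iter_bracket Y (i # I) x $ j - iter_bracket S (i # I) x $ j)"
    if U: "unit_gauge U d" and \<eta>: "0 \<le> \<eta>" and Y: "fields_bounded d U M s A Y"
      and S: "fields_bounded d U M s A S" and YS: "fields_close d U \<eta> s A Y S"
    for U d \<eta> and Y S :: "nat \<Rightarrow> real ^ 'p \<Rightarrow> real ^ 'p" and j
    unfolding iter_bracket_Cons[OF Cons.hyps] mult.assoc[of _ ?D \<eta>]
  proof (rule Ck_flat_lie_bracket_diff[OF unit_gaugeD[OF U], where e' = "Suc ?k"])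
    note d = unit_gaugeD(2)[OF U]
    have \<eta>': "\<eta> \<le> ?D * \<eta>" "D * \<eta> \<le> ?D * \<eta>" "0 \<le> D * \<eta>"
      using mult_right_mono[of 1 ?D \<eta>] \<eta> D(1) by (auto intro: mult_right_mono)
    have "Ck_flat d U 0 M (s - wt i) (\<lambda>x. Y i x $ j)" "Ck_flat d U 0 M (s - wt i) (\<lambda>x. S i x $ j)"
      "Ck_flat d U (s - wt i) \<eta> (s - wt i) (\<lambda>x. Y i x $ j - S i x $ j)" for j
      using Y S YS k(3) by (auto simp: fields_bounded_def fields_close_def)
    note i = this
    show "Ck_flat d U 0 ?M (Suc ?k) (\<lambda>x. Y i x $ j)" for j
      by (rule Ck_flat_mono[OF i(1) max.cobounded1 \<open>0 \<le> M\<close> order_refl k(1) d])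
    show "Ck_flat d U 0 ?M (Suc ?k) (\<lambda>x. S i x $ j)" for j
      by (rule Ck_flat_mono[OF i(2) max.cobounded1 \<open>0 \<le> M\<close> order_refl k(1) d])
    show "Ck_flat d U 0 ?M (Suc ?k) (\<lambda>x. iter_bracket Y I x $ j)" for j
      by (rule Ck_flat_mono[OF C(2)[OF U Y] max.cobounded2 C(1) order_refl k(2) d])
    show "Ck_flat d U 0 ?M (Suc ?k) (\<lambda>x. iter_bracket S I x $ j)" for j
      by (rule Ck_flat_mono[OF C(2)[OF U S] max.cobounded2 C(1) order_refl k(2) d])
    show "Ck_flat d U (Suc ?k) (?D * \<eta>) (Suc ?k) (\<lambda>x. Y i x $ j - S i x $ j)" for j
      by (rule Ck_flat_mono[OF i(3) \<eta>'(1) \<eta> k(1) k(1) d])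
    show "Ck_flat d U (Suc ?k) (?D * \<eta>) (Suc ?k) (\<lambda>x. iter_bracket Y I x $ j - iter_bracket S I x $ j)"
      for j
      by (rule Ck_flat_mono[OF D(2)[OF U \<eta> Y S YS] \<eta>'(2,3) k(2) k(2) d])
    show "0 \<le> ?D * \<eta>" using \<eta> by simp
  qed (use \<open>0 \<le> M\<close> in auto)
  moreover have "0 \<le> real CARD('p) * (4 * 2 ^ ?k * ?M) * ?D" using \<open>0 \<le> M\<close> by simp
  ultimately show ?case by blast
qed

section \<open>Taylor polynomials\<close>

lemma pderivs_append: "pderivs (u @ v) f = pderivs u (pderivs v f)"
  by (induction u) auto

lemma Ck_flat_pderivs:
  "Ck_flat d U e M (length v + k) f \<Longrightarrow> Ck_flat d U (e - length v) M k (pderivs v f)"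
proof (induction v arbitrary: k)
  case (Cons j v)
  then have "Ck_flat d U e M (length v + Suc k) f" by (simp del: Ck_flat.simps)
  from Ck_flat_pderiv1[OF Cons.IH[OF this], of j] show ?case by simp
qed simp

lemma pderivs_cong:
  assumes "open U" "x \<in> U" "\<And>y. y \<in> U \<Longrightarrow> f y = g y"
  shows "pderivs \<alpha> f x = pderivs \<alpha> g x"
  using assms(2)
proof (induction \<alpha> arbitrary: x)
  case Nil
  then show ?case by (simp add: assms(3))
next
  case (Cons j \<alpha>)
  then show ?case unfolding pderivs.simps by (blast intro: pderiv1_cong[OF assms(1)])
qed

text \<open>Mixed partial derivatives commute only up to the order of differentiability, whence the
  bound \<open>N\<close> on the length of the lists.\<close>

definition swap_invariant :: "nat \<Rightarrow> ('a list \<Rightarrow> 'b) \<Rightarrow> bool" where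
  "swap_invariant N c \<longleftrightarrow>
     (\<forall>u v i j. length u + length v + 2 \<le> N \<longrightarrow> c (u @ i # j # v) = c (u @ j # i # v))"

lemma swap_invariant_Cons: "swap_invariant (Suc N) c \<Longrightarrow> swap_invariant N (\<lambda>\<beta>. c (i # \<beta>))"
  unfolding swap_invariant_def by (metis add_Suc append_Cons length_Cons not_less_eq_eq)

lemma swap_invariant_mono: "swap_invariant N c \<Longrightarrow> N' \<le> N \<Longrightarrow> swap_invariant N' c"
  unfolding swap_invariant_def by auto

text \<open>Differentiating a homogeneous polynomial puts \<open>i\<close> at the head of the list,
  whereas the derivatives of \<open>pderiv1 i f\<close> carry \<open>i\<close> at the end, since
  \<open>pderivs\<close> applies the last entry first. Adjacent swaps lead from one to the
  other.\<close>

lemma swap_invariant_rotate: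
  assumes "swap_invariant N c" "length u + length \<beta> + 1 \<le> N"
  shows "c (u @ i # \<beta>) = c (u @ \<beta> @ [i])"
  using assms(2)
proof (induction \<beta> arbitrary: u)
  case (Cons j \<beta>)
  have "c (u @ i # j # \<beta>) = c ((u @ [j]) @ i # \<beta>)"
    using assms(1) Cons.prems unfolding swap_invariant_def by auto
  also have "\<dots> = c ((u @ [j]) @ \<beta> @ [i])" using Cons.IH[of "u @ [j]"] Cons.prems by simp
  finally show ?case by simp
qed simp

text \<open>The pair \<open>i\<close>, \<open>j\<close> acts on \<open>pderivs v f\<close>, which
  still has two continuous derivatives. The two results agree on all of the open set
  \<open>U\<close>, and therefore so do their derivatives \<open>u\<close>.\<close>

lemma swap_invariant_pderivs:
  assumes "open U" "x \<in> U" "Ck_flat d U e M N f"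
  shows "swap_invariant N (\<lambda>\<alpha>. pderivs \<alpha> f x)"
  unfolding swap_invariant_def
proof (intro allI impI)
  fix u v :: "'a list" and i j
  assume len: "length u + length v + 2 \<le> N"
  then obtain k where "N = length v + Suc (Suc k)"
    by (metis add.commute add_2_eq_Suc' add_leD2 add_le_imp_le_diff le_Suc_ex group_cancel.add1 add.assoc)
  with assms(3) have "Ck_flat d U (e - length v) M (Suc (Suc k)) (pderivs v f)"
    by (intro Ck_flat_pderivs) simp
  then have "pderiv1 i (pderiv1 j (pderivs v f)) y = pderiv1 j (pderiv1 i (pderivs v f)) y" if "y \<in> U"
    for y
    using pderiv1_commute assms(1) that by blast
  then have "pderivs u (pderivs (i # j # v) f) x = pderivs u (pderivs (j # i # v) f) x"
    by (intro pderivs_cong[OF assms(1,2)]) simp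
  then show "pderivs (u @ i # j # v) f x = pderivs (u @ j # i # v) f x" by (simp only: pderivs_append)
qed

section \<open>Homogeneous polynomials and the Taylor remainder\<close>

definition hpoly :: "nat \<Rightarrow> ('p list \<Rightarrow> real) \<Rightarrow> real ^ 'p \<Rightarrow> real" where
  "hpoly m c y = (\<Sum>\<alpha> | length \<alpha> = m. c \<alpha> * (\<Prod>j\<leftarrow>\<alpha>. y $ j))"

lemma hpoly_0 [simp]: "hpoly 0 c y = c []"
  by (simp add: hpoly_def)

text \<open>Summation over lists rather than multi-indices allows the first variable to be split
  off; this recursion replaces all combinatorics of multi-indices below.\<close>

lemma hpoly_Suc: "hpoly (Suc m) c y = (\<Sum>j\<in>UNIV. y $ j * hpoly m (\<lambda>\<beta>. c (j # \<beta>)) y)"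
proof -
  have eq: "{\<alpha> :: 'a list. length \<alpha> = Suc m} = (\<lambda>(j, \<beta>). j # \<beta>) ` (UNIV \<times> {\<beta>. length \<beta> = m})"
    by (auto simp: length_Suc_conv image_iff)
  have "hpoly (Suc m) c y = (\<Sum>(j, \<beta>)\<in>UNIV \<times> {\<beta>. length \<beta> = m}. c (j # \<beta>) * (y $ j * (\<Prod>j\<leftarrow>\<beta>. y $ j)))"
    unfolding hpoly_def eq
    by (subst sum.reindex) (auto simp: inj_on_def o_def case_prod_beta)
  also have "\<dots> = (\<Sum>j\<in>UNIV. \<Sum>\<beta> | length \<beta> = m. c (j # \<beta>) * (y $ j * (\<Prod>j\<leftarrow>\<beta>. y $ j)))"
    by (rule sum.cartesian_product[symmetric])
  finally show ?thesis by (simp add: hpoly_def sum_distrib_left mult_ac)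
qed

lemma hpoly_cong: "(\<And>\<beta>. length \<beta> = m \<Longrightarrow> c \<beta> = c' \<beta>) \<Longrightarrow> hpoly m c y = hpoly m c' y"
  by (simp add: hpoly_def)

lemma taylor_poly_hpoly:
  "taylor_poly k f x0 x = (\<Sum>m\<le>k. hpoly m (\<lambda>\<alpha>. pderivs \<alpha> f x0) (x - x0) / fact m)"
  by (simp add: taylor_poly_def hpoly_def sum_divide_distrib)

lemma has_derivative_component: "((\<lambda>x::real ^ 'p. (x - x0) $ j) has_derivative (\<lambda>h. (h - 0) $ j)) (at x)"
  by (intro bounded_linear.has_derivative[OF bounded_linear_vec_nth] has_derivative_diff
      has_derivative_ident has_derivative_const)

lemma differentiable_component: "(\<lambda>x::real ^ 'p. (x - x0) $ j) differentiable (at x)"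
  using has_derivative_component differentiable_def by blast

lemma pderiv1_component:
  "pderiv1 i (\<lambda>x::real ^ 'p. (x - x0) $ j) x = (if i = j then 1 else 0)"
  using pderiv1_unique[OF has_derivative_component, of i x0 j x] by (simp add: axis_def)

lemma differentiable_hpoly: "(\<lambda>x. hpoly m c (x - x0)) differentiable (at x)"
proof (induction m arbitrary: c)
  case (Suc m)
  then show ?case unfolding hpoly_Suc
    by (intro differentiable_sum differentiable_mult differentiable_component ballI finite Suc.IH)
qed simp

lemma pderiv1_sum:
  assumes "finite A" "\<And>a. a \<in> A \<Longrightarrow> f a differentiable (at x)"
  shows "pderiv1 j (\<lambda>x. \<Sum>a\<in>A. f a x) x = (\<Sum>a\<in>A. pderiv1 j (f a) x)"
  using assms
proof (induction A rule: finite_induct)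
  case (insert a A)
  then show ?case by (simp add: pderiv1_add differentiable_sum)
qed simp

text \<open>The product rule gives one term from the split-off variable. The remaining terms
  contribute \<open>m\<close> times the same polynomial, by induction and after a swap of the two
  leading indices.\<close>

lemma pderiv1_hpoly:
  assumes "swap_invariant (Suc m) c"
  shows "pderiv1 i (\<lambda>x. hpoly (Suc m) c (x - x0)) x = real (Suc m) * hpoly m (\<lambda>\<beta>. c (i # \<beta>)) (x - x0)"
  using assms
proof (induction m arbitrary: c)
  have step: "pderiv1 i (\<lambda>x. hpoly (Suc m) c (x - x0)) x = hpoly m (\<lambda>\<beta>. c (i # \<beta>)) (x - x0) +
     (\<Sum>j\<in>UNIV. (x - x0) $ j * pderiv1 i (\<lambda>x. hpoly m (\<lambda>\<beta>. c (j # \<beta>)) (x - x0)) x)" for m c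
  proof -
    have "pderiv1 i (\<lambda>x. hpoly (Suc m) c (x - x0)) x =
       (\<Sum>j\<in>UNIV. (if i = j then 1 else 0) * hpoly m (\<lambda>\<beta>. c (j # \<beta>)) (x - x0) +
         (x - x0) $ j * pderiv1 i (\<lambda>x. hpoly m (\<lambda>\<beta>. c (j # \<beta>)) (x - x0)) x)"
      unfolding hpoly_Suc
      by (subst pderiv1_sum)
        (auto intro!: differentiable_mult differentiable_component differentiable_hpoly sum.cong
          simp only: pderiv1_mult[OF differentiable_component differentiable_hpoly] pderiv1_component finite)
    then show ?thesis by (simp add: sum.distrib if_distrib[of "\<lambda>t. t * _"] cong: if_cong)
  qed
  {
    case 0
    show ?case unfolding step by simp
  next
    case (Suc m)
    have "hpoly m (\<lambda>\<beta>. c (j # i # \<beta>)) (x - x0) = hpoly m (\<lambda>\<beta>. c (i # j # \<beta>)) (x - x0)" for j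
      using Suc.prems unfolding swap_invariant_def
      by (intro hpoly_cong)
        (metis add_2_eq_Suc' append_Nil length_0_conv list.size(3) order_refl plus_nat.add_0)
    then have "pderiv1 i (\<lambda>x. hpoly (Suc m) (\<lambda>\<beta>. c (j # \<beta>)) (x - x0)) x
        = real (Suc m) * hpoly m (\<lambda>\<beta>. c (i # j # \<beta>)) (x - x0)" for j
      using Suc.IH[OF swap_invariant_Cons[OF Suc.prems], of j] by simp
    moreover have "(\<Sum>j\<in>UNIV. (x - x0) $ j * (real (Suc m) * hpoly m (\<lambda>\<beta>. c (i # j # \<beta>)) (x - x0)))
        = real (Suc m) * hpoly (Suc m) (\<lambda>\<beta>. c (i # \<beta>)) (x - x0)"
      unfolding hpoly_Suc[of m "\<lambda>\<beta>. c (i # \<beta>)"] sum_distrib_left by (simp only: mult_ac)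
    ultimately show ?case unfolding step[of "Suc m"] by (simp add: algebra_simps)
  }
qed

text \<open>The factor \<open>Suc m\<close> from differentiation cancels against the factorial. As a
  consequence the derivative of a Taylor remainder is the remainder of the derivative, so that
  remainders can be estimated by induction on the order.\<close>

lemma pderiv1_taylor_poly:
  assumes "swap_invariant (Suc k) (\<lambda>\<alpha>. pderivs \<alpha> f x0)"
  shows "pderiv1 i (taylor_poly (Suc k) f x0) x = taylor_poly k (pderiv1 i f) x0 x"
proof -
  let ?c = "\<lambda>\<alpha>. pderivs \<alpha> f x0"
  have "pderiv1 i (\<lambda>x. hpoly (Suc m) ?c (x - x0) / fact (Suc m)) x
      = hpoly m (\<lambda>\<alpha>. pderivs \<alpha> (pderiv1 i f) x0) (x - x0) / fact m" if "m \<le> k" for m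
  proof -
    have "?c (i # \<beta>) = pderivs \<beta> (pderiv1 i f) x0" if "length \<beta> = m" for \<beta>
      using swap_invariant_rotate[OF assms, of "[]" \<beta> i] that \<open>m \<le> k\<close> by (simp add: pderivs_append)
    then have "hpoly m (\<lambda>\<beta>. ?c (i # \<beta>)) (x - x0) = hpoly m (\<lambda>\<alpha>. pderivs \<alpha> (pderiv1 i f) x0) (x - x0)"
      by (intro hpoly_cong)
    moreover have "pderiv1 i (\<lambda>x. hpoly (Suc m) ?c (x - x0)) x = real (Suc m) * hpoly m (\<lambda>\<beta>. ?c (i # \<beta>))
      (x - x0)"
      using assms that by (intro pderiv1_hpoly) (auto elim: swap_invariant_mono)
    moreover have "pderiv1 i (\<lambda>x. inverse (fact (Suc m)) * hpoly (Suc m) ?c (x - x0)) x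
        = inverse (fact (Suc m)) * pderiv1 i (\<lambda>x. hpoly (Suc m) ?c (x - x0)) x"
      using pderiv1_mult[OF differentiable_const differentiable_hpoly, of i "inverse (fact (Suc m))"
        "Suc m" ?c x0 x] by simp
    ultimately show ?thesis by (simp add: divide_inverse mult_ac)
  qed
  moreover have "pderiv1 i (taylor_poly (Suc k) f x0) x =
     (\<Sum>m\<le>Suc k. pderiv1 i (\<lambda>x. hpoly m ?c (x - x0) / fact m) x)"
    unfolding taylor_poly_hpoly[abs_def]
    by (rule pderiv1_sum) (auto simp: divide_inverse intro!: differentiable_mult differentiable_hpoly)
  ultimately show ?thesis
    by (simp add: taylor_poly_hpoly sum.atMost_Suc_shift del: sum.atMost_Suc fact_Suc)
qed

lemma differentiable_taylor_poly: "taylor_poly k f x0 differentiable (at x)"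
  unfolding taylor_poly_hpoly[abs_def]
  by (intro differentiable_sum)
    (auto simp: divide_inverse intro!: differentiable_mult differentiable_hpoly)

lemma taylor_poly_center: "taylor_poly k f x0 x0 = f x0"
proof -
  have "hpoly m (\<lambda>\<alpha>. pderivs \<alpha> f x0) (x0 - x0) / fact m = (if m = 0 then f x0 else 0)" for m
    by (cases m) (auto simp: hpoly_Suc)
  then show ?thesis unfolding taylor_poly_hpoly by simp
qed

lemma pderiv1_mean_value:
  fixes g :: "real ^ 'p \<Rightarrow> real"
  assumes "convex S" and g: "\<And>y. y \<in> S \<Longrightarrow> g differentiable (at y)"
    and B: "\<And>y j. y \<in> S \<Longrightarrow> \<bar>pderiv1 j g y\<bar> \<le> B" and "x \<in> S" "y \<in> S"
  shows "\<bar>g x - g y\<bar> \<le> real CARD('p) * B * dist x y"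
proof -
  have "norm (g x - g y) \<le> real CARD('p) * B * norm (x - y)"
  proof (rule differentiable_bound[OF assms(1)])
    show "(g has_derivative frechet_derivative g (at z)) (at z within S)" if "z \<in> S" for z
      using g[OF that] frechet_derivative_works has_derivative_at_withinI by blast
    show "onorm (frechet_derivative g (at z)) \<le> real CARD('p) * B" if "z \<in> S" for z
    proof (rule onorm_bound)
      have "0 \<le> B" using B[OF that] abs_ge_zero order_trans by blast
      then show "0 \<le> real CARD('p) * B" by simp
      have lin: "linear (frechet_derivative g (at z))" using g[OF that] linear_frechet_derivative
        by blast
      fix h :: "real ^ 'p"
      have "frechet_derivative g (at z) h = frechet_derivative g (at z) (\<Sum>j\<in>UNIV. (h $ j) *\<^sub>R axis j 1)"
        using basis_expansion[of h] by (simp add: scalar_mult_eq_scaleR)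
      also have "\<dots> = (\<Sum>j\<in>UNIV. h $ j * pderiv1 j g z)"
        using lin by (simp add: linear_sum linear_cmul pderiv1_def o_def)
      finally have "norm (frechet_derivative g (at z) h) \<le> (\<Sum>j\<in>UNIV. \<bar>h $ j * pderiv1 j g z\<bar>)" by simp
      also have "\<dots> \<le> (\<Sum>j\<in>(UNIV::'p set). norm h * B)"
        unfolding abs_mult using B[OF that] component_le_norm_cart[of h]
          by (intro sum_mono mult_mono) auto
      finally show "norm (frechet_derivative g (at z) h) \<le> real CARD('p) * B * norm h"
        by (simp add: mult_ac)
    qed
  qed (use assms in auto)
  then show ?thesis by (simp add: dist_norm)
qed

text \<open>The induction hypothesis bounds the first derivatives of the remainder, which vanishes
  at the centre; the mean value estimate then gains one power of the distance at the price of one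
  factor \<open>CARD('p)\<close>. Only the oscillation \<eta> of the derivatives of highest order
  enters the constant, so mere continuity of these makes it small.\<close>

lemma Ck_flat_taylor_remainder:
  fixes f :: "real ^ 'p \<Rightarrow> real"
  assumes "0 < R" "R \<le> 1" "0 \<le> \<eta>" "Ck_flat d (ball x0 R) 0 M k f"
    and "\<And>\<alpha> x. length \<alpha> = k \<Longrightarrow> x \<in> ball x0 R \<Longrightarrow> \<bar>pderivs \<alpha> f x - pderivs \<alpha> f x0\<bar> \<le> \<eta>"
  shows "Ck_flat (\<lambda>x. min 1 (dist x x0)) (ball x0 R) k (real CARD('p) ^ k * \<eta>) k
    (\<lambda>x. f x - taylor_poly k f x0 x)"
  using assms(4,5)
proof (induction k arbitrary: f)
  case 0
  have "taylor_poly 0 f x0 x = f x0" for x by (simp add: taylor_poly_hpoly)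
  then show ?case using 0(1) 0(2)[of "[]"] by (auto intro: continuous_intros)
next
  case (Suc k)
  let ?U = "ball x0 R" and ?d = "\<lambda>x. min 1 (dist x x0)" and ?p = "real CARD('p)"
  let ?g = "\<lambda>x. f x - taylor_poly (Suc k) f x0 x"
  have p: "1 \<le> ?p" using zero_less_card_finite[where 'a='p] by linarith
  have x0: "x0 \<in> ?U" using \<open>0 < R\<close> by simp
  have f: "f differentiable (at x)" if "x \<in> ?U" for x using Suc.prems(1) that by simp
  have dg: "?g differentiable (at x)" if "x \<in> ?U" for x
    using f[OF that] differentiable_taylor_poly by (rule differentiable_diff)
  have eq: "pderiv1 j ?g x = pderiv1 j f x - taylor_poly k (pderiv1 j f) x0 x" if "x \<in> ?U" for x j
    using pderiv1_diff[OF f[OF that] differentiable_taylor_poly]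
      pderiv1_taylor_poly[OF swap_invariant_pderivs[OF open_ball x0 Suc.prems(1)]] by simp
  have IH: "Ck_flat ?d ?U k (?p ^ k * \<eta>) k (\<lambda>x. pderiv1 j f x - taylor_poly k (pderiv1 j f) x0 x)" for j
  proof (rule Suc.IH)
    show "Ck_flat d ?U 0 M k (pderiv1 j f)" using Suc.prems(1) by simp
    show "\<bar>pderivs \<alpha> (pderiv1 j f) x - pderivs \<alpha> (pderiv1 j f) x0\<bar> \<le> \<eta>"
      if "length \<alpha> = k" "x \<in> ?U" for \<alpha> x
      using Suc.prems(2)[of "\<alpha> @ [j]" x] that by (simp add: pderivs_append)
  qed
  have "?p ^ k * \<eta> \<le> ?p ^ Suc k * \<eta>"
    using p \<open>0 \<le> \<eta>\<close> by (intro mult_right_mono power_increasing) auto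
  then have IH': "Ck_flat ?d ?U k (?p ^ Suc k * \<eta>) k (pderiv1 j ?g)" for j
    using eq \<open>0 \<le> \<eta>\<close> by (intro Ck_flat_cong[OF open_ball Ck_flat_mono[OF IH[of j]]]) auto
  have "\<bar>?g x\<bar> \<le> ?p ^ Suc k * \<eta> * ?d x ^ Suc k" if x: "x \<in> ?U" for x
  proof -
    have dx: "?d x = dist x x0" using x \<open>R \<le> 1\<close> by (simp add: dist_commute)
    have "\<bar>?g x - ?g x0\<bar> \<le> ?p * (?p ^ k * \<eta> * dist x x0 ^ k) * dist x x0"
    \<comment> \<open>On this convex set every point is at most as far from the centre as
      \<open>x\<close>, so the bound for the derivatives is uniform there.\<close>
    proof (rule pderiv1_mean_value[of "cball x0 (dist x x0) \<inter> ?U"])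
      fix y j assume y: "y \<in> cball x0 (dist x x0) \<inter> ?U"
      have "\<bar>pderiv1 j ?g y\<bar> \<le> ?p ^ k * \<eta> * ?d y ^ k"
        using Ck_flat_bound[OF IH, of y j] eq y by simp
      also have "\<dots> \<le> ?p ^ k * \<eta> * dist x x0 ^ k"
        using y \<open>0 \<le> \<eta>\<close> by (intro mult_left_mono power_mono) (auto simp: dist_commute)
      finally show "\<bar>pderiv1 j ?g y\<bar> \<le> ?p ^ k * \<eta> * dist x x0 ^ k" .
    qed (use x x0 dg in \<open>auto simp: dist_commute intro: convex_Int\<close>)
    then show ?thesis by (simp add: taylor_poly_center dx mult_ac)
  qed
  then show ?case using dg IH' by simp
qed

section \<open>Uniform bounds for Taylor polynomials\<close>

lemma Ck_flat_component:
  fixes U :: "(real ^ 'p) set"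
  assumes "1 \<le> L" "\<And>x. x \<in> U \<Longrightarrow> dist x x0 \<le> L"
  shows "Ck_flat d U 0 L k (\<lambda>x. (x - x0) $ j)"
proof (cases k)
  have b: "\<bar>(x - x0) $ j\<bar> \<le> L" if "x \<in> U" for x
    using component_le_norm_cart[of "x - x0" j] assms(2)[OF that] by (simp add: dist_norm)
  {
    case 0
    then show ?thesis using b by (auto intro!: continuous_intros)
  next
    case (Suc k')
    have "pderiv1 i (\<lambda>x. (x - x0) $ j) = (\<lambda>x. if i = j then 1 else 0)" for i
      using pderiv1_component by blast
    then show ?thesis using b Suc differentiable_component[of x0 j] \<open>1 \<le> L\<close>
      by (auto intro!: Ck_flat_const)
  }
qed

text \<open>The order \<open>k\<close> is unrelated to the degree \<open>m\<close>, as polynomials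
  are smooth. The constant sees only the size \<open>L\<close> of the region and the size
  \<open>M\<close> of the coefficients, not the centre.\<close>

lemma Ck_flat_hpoly:
  assumes "1 \<le> L" "0 \<le> M"
  shows "\<exists>C\<ge>0. \<forall>U d (x0 :: real ^ 'p) c. unit_gauge U d \<longrightarrow> (\<forall>x\<in>U. dist x x0 \<le> L) \<longrightarrow>
    (\<forall>\<alpha>. length \<alpha> = m \<longrightarrow> \<bar>c \<alpha>\<bar> \<le> M) \<longrightarrow> Ck_flat d U 0 C k (\<lambda>x. hpoly m c (x - x0))"
proof (induction m)
  case 0
  show ?case unfolding hpoly_0 using \<open>0 \<le> M\<close> by (metis Ck_flat_const list.size(3))
next
  case (Suc m)
  then obtain C where C: "C \<ge> 0" "\<And>U d (x0 :: real ^ 'p) c. unit_gauge U d \<Longrightarrow> \<forall>x\<in>U. dist x x0 \<le> L \<Longrightarrow>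
    \<forall>\<alpha>. length \<alpha> = m \<longrightarrow> \<bar>c \<alpha>\<bar> \<le> M \<Longrightarrow> Ck_flat d U 0 C k (\<lambda>x. hpoly m c (x - x0))"
    by blast
  have "Ck_flat d U 0 (real CARD('p) * (2 ^ k * (L * C))) k (\<lambda>x. hpoly (Suc m) c (x - x0))"
    if "unit_gauge U d" "\<forall>x\<in>U. dist x x0 \<le> L" "\<forall>\<alpha>. length \<alpha> = Suc m \<longrightarrow> \<bar>c \<alpha>\<bar> \<le> M"
    for U d and x0 :: "real ^ 'p" and c
    unfolding hpoly_Suc
  proof (intro Ck_flat_sum Ck_flat_mult)
    show "Ck_flat d U 0 L k (\<lambda>x. (x - x0) $ j)" for j
      using that \<open>1 \<le> L\<close> by (intro Ck_flat_component) auto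
    show "Ck_flat d U 0 C k (\<lambda>x. hpoly m (\<lambda>\<beta>. c (j # \<beta>)) (x - x0))" for j
      using that by (intro C(2)) auto
  qed (use that \<open>1 \<le> L\<close> \<open>C \<ge> 0\<close> unit_gaugeD[OF that(1)] in auto)
  moreover have "0 \<le> real CARD('p) * (2 ^ k * (L * C))" using \<open>1 \<le> L\<close> \<open>C \<ge> 0\<close> by simp
  ultimately show ?case by blast
qed

lemma Ck_flat_taylor_poly:
  assumes "1 \<le> L" "0 \<le> M"
  shows "\<exists>C\<ge>0. \<forall>U d (x0 :: real ^ 'p) f. unit_gauge U d \<longrightarrow> (\<forall>x\<in>U. dist x x0 \<le> L) \<longrightarrow>
    (\<forall>\<alpha>. length \<alpha> \<le> m \<longrightarrow> \<bar>pderivs \<alpha> f x0\<bar> \<le> M) \<longrightarrow> Ck_flat d U 0 C k (taylor_poly m f x0)"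
proof (induction m)
  case 0
  have "taylor_poly 0 f x0 = (\<lambda>x. f x0)" for f and x0 :: "real ^ 'p" by (auto simp: taylor_poly_hpoly)
  then show ?case using \<open>0 \<le> M\<close> by (metis Ck_flat_const list.size(3) order_refl pderivs.simps(1))
next
  case (Suc m)
  then obtain C where C: "C \<ge> 0" "\<And>U d (x0 :: real ^ 'p) f. unit_gauge U d \<Longrightarrow> \<forall>x\<in>U. dist x x0 \<le> L \<Longrightarrow>
    \<forall>\<alpha>. length \<alpha> \<le> m \<longrightarrow> \<bar>pderivs \<alpha> f x0\<bar> \<le> M \<Longrightarrow> Ck_flat d U 0 C k (taylor_poly m f x0)"
    by blast
  obtain D where D: "D \<ge> 0" "\<And>U d (x0 :: real ^ 'p) c. unit_gauge U d \<Longrightarrow> \<forall>x\<in>U. dist x x0 \<le> L \<Longrightarrow>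
    \<forall>\<alpha>. length \<alpha> = Suc m \<longrightarrow> \<bar>c \<alpha>\<bar> \<le> M \<Longrightarrow> Ck_flat d U 0 D k (\<lambda>x. hpoly (Suc m) c (x - x0))"
    using Ck_flat_hpoly[OF assms, of "Suc m" k, where 'p = 'p] by blast
  have eq: "taylor_poly (Suc m) f x0 = (\<lambda>x. taylor_poly m f x0 x +
      inverse (fact (Suc m)) * hpoly (Suc m) (\<lambda>\<alpha>. pderivs \<alpha> f x0) (x - x0))" for f and x0 :: "real ^ 'p"
    by (simp add: fun_eq_iff taylor_poly_hpoly divide_inverse mult_ac)
  have inv: "\<bar>inverse (fact (Suc m))\<bar> \<le> (1 :: real)"
    using fact_ge_1[of "Suc m", where 'a = real] by (simp add: inverse_le_1_iff del: fact_Suc)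
  have "Ck_flat d U 0 (C + 1 * D) k (taylor_poly (Suc m) f x0)"
    if "unit_gauge U d" "\<forall>x\<in>U. dist x x0 \<le> L" "\<forall>\<alpha>. length \<alpha> \<le> Suc m \<longrightarrow> \<bar>pderivs \<alpha> f x0\<bar> \<le> M"
    for U d and x0 :: "real ^ 'p" and f
    unfolding eq
  proof (intro Ck_flat_add Ck_flat_scale)
    show "Ck_flat d U 0 C k (taylor_poly m f x0)"
      using that by (intro C(2)) auto
    show "Ck_flat d U 0 D k (\<lambda>x. hpoly (Suc m) (\<lambda>\<alpha>. pderivs \<alpha> f x0) (x - x0))"
      using that by (intro D(2)) auto
  qed (use unit_gaugeD[OF that(1)] inv \<open>D \<ge> 0\<close> in \<open>auto simp del: fact_Suc\<close>)
  moreover have "0 \<le> C + 1 * D" using \<open>C \<ge> 0\<close> \<open>D \<ge> 0\<close> by simp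
  ultimately show ?case by blast
qed

section \<open>Admissible curves\<close>

lemma negligible_outer_open:
  assumes "negligible E" "0 < e"
  obtains T where "open T" "E \<subseteq> T" "T \<in> lmeasurable" "measure lebesgue T < e"
proof -
  have E: "E \<in> null_sets lebesgue" using assms(1) negligible_iff_null_sets by blast
  then have "E \<in> sets lebesgue" by auto
  from sets_lebesgue_outer_open[OF this assms(2)]
  obtain T where T: "open T" "E \<subseteq> T" "T - E \<in> lmeasurable" "emeasure lebesgue (T - E) < ennreal e"
    by metis
  have eq: "T = (T - E) \<union> E" using T(2) by auto
  have "emeasure lebesgue T = emeasure lebesgue (T - E)"
    using emeasure_Un_null_set[of "T - E" lebesgue E] T(3) E eq by (simp add: fmeasurableD)
  moreover have "T \<in> sets lebesgue" using T(1) by (simp add: borel_open sets_completionI_sets)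
  ultimately have "T \<in> lmeasurable" "measure lebesgue T < e"
    using T(3,4) assms(2) by (auto simp: fmeasurable_def measure_def enn2real_less_iff)
  then show ?thesis using that T by blast
qed

lemma AE_lebesgue_onE:
  assumes "AE t in lebesgue_on S. P t" "S \<in> sets lebesgue"
  obtains E where "negligible E" "\<And>t. t \<in> S \<Longrightarrow> t \<notin> E \<Longrightarrow> P t"
proof -
  have "AE t in lebesgue. t \<in> S \<longrightarrow> P t"
    using assms by (simp add: AE_restrict_space_iff)
  then show ?thesis
    using that unfolding eventually_ae_filter negligible_iff_null_sets by auto
qed

lemma AE_lebesgue_on_mono:
  assumes "AE t in lebesgue_on S. P t" "\<And>t. t \<in> S \<Longrightarrow> P t \<Longrightarrow> Q t"
  shows "AE t in lebesgue_on S. Q t"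
  by (rule AE_mp[OF assms(1)], rule AE_I2) (simp add: assms(2))

lemma abs_continuous_on_continuous:
  assumes "abs_continuous_on {a..b} \<phi>"
  shows "continuous_on {a..b} \<phi>"
  unfolding continuous_on_iff
proof (intro ballI allI impI)
  fix x and e :: real assume x: "x \<in> {a..b}" and "e > 0"
  then obtain \<eta> where \<eta>: "\<eta> > 0" "\<And>D T. D division_of T \<Longrightarrow> T \<subseteq> {a..b} \<Longrightarrow> (\<Sum>k\<in>D. Sup k - Inf k) < \<eta> \<Longrightarrow>
        (\<Sum>k\<in>D. norm (\<phi> (Sup k) - \<phi> (Inf k))) < e"
    using assms unfolding abs_continuous_on_def by meson
  have *: "norm (\<phi> v - \<phi> u) < e" if "u \<in> {a..b}" "v \<in> {a..b}" "u \<le> v" "v - u < \<eta>" for u v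
    using \<eta>(2)[of "{{u..v}}" "{u..v}"] that division_of_self[of u v] by auto
  have "dist (\<phi> y) (\<phi> x) < e" if "y \<in> {a..b}" "dist y x < \<eta>" for y
    using *[of x y] *[of y x] that x
    by (cases "x \<le> y") (auto simp: dist_norm norm_minus_commute)
  then show "\<exists>d>0. \<forall>y\<in>{a..b}. dist y x < d \<longrightarrow> dist (\<phi> y) (\<phi> x) < e" using \<eta>(1) by blast
qed

text \<open>On a division of \<open>[c, d]\<close> that is fine for a suitable gauge, the intervals tagged in the
  exceptional null set have small total length and hence contribute little by absolute continuity;
  the others satisfy the mean value estimate.\<close>

lemma abs_continuous_on_growth:
  fixes \<phi> :: "real \<Rightarrow> 'a::real_normed_vector"
  assumes ac: "abs_continuous_on {a..b} \<phi>" and "0 \<le> C"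
    and ae: "AE t in lebesgue_on {a..b}. \<exists>v. (\<phi> has_vector_derivative v) (at t within {a..b}) \<and> norm v \<le>
      C"
    and cd: "a \<le> c" "c \<le> d" "d \<le> b"
  shows "norm (\<phi> d - \<phi> c) \<le> C * (d - c)"
proof (rule field_le_epsilon)
  fix \<epsilon>0 :: real assume "0 < \<epsilon>0"
  \<comment> \<open>The intervals tagged in the null set will cost \<epsilon>, and the others
    \<epsilon> times their total length, at most \<open>d - c\<close>.\<close>
  define \<epsilon> where "\<epsilon> = \<epsilon>0 / (1 + (d - c))"
  have \<epsilon>: "0 < \<epsilon>" "\<epsilon> * (1 + (d - c)) = \<epsilon>0" using \<open>0 < \<epsilon>0\<close> cd by (auto simp: \<epsilon>_def)
  obtain \<eta> where \<eta>: "\<eta> > 0" "\<And>D T. D division_of T \<Longrightarrow> T \<subseteq> {a..b} \<Longrightarrow> (\<Sum>k\<in>D. Sup k - Inf k) < \<eta> \<Longrightarrow>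
      (\<Sum>k\<in>D. norm (\<phi> (Sup k) - \<phi> (Inf k))) < \<epsilon>"
    using ac \<epsilon>(1) unfolding abs_continuous_on_def by meson
  have "{a..b} \<in> sets lebesgue" by simp
  from AE_lebesgue_onE[OF ae this] obtain E where E: "negligible E"
    "\<And>t. t \<in> {a..b} \<Longrightarrow> t \<notin> E \<Longrightarrow> \<exists>v. (\<phi> has_vector_derivative v) (at t within {a..b}) \<and> norm v \<le> C"
    by metis
  obtain U where U: "open U" "E \<subseteq> U" "U \<in> lmeasurable" "measure lebesgue U < \<eta>"
    using negligible_outer_open[OF E(1) \<eta>(1)] .
  have "\<exists>\<gamma>. open \<gamma> \<and> x \<in> \<gamma> \<and> (x \<in> E \<longrightarrow> \<gamma> \<subseteq> U) \<and>
      (x \<in> {a..b} - E \<longrightarrow> (\<forall>y\<in>\<gamma> \<inter> {a..b}. norm (\<phi> y - \<phi> x) \<le> (C + \<epsilon>) * \<bar>y - x\<bar>))" for x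
  proof (cases "x \<in> {a..b} - E")
    case True
    then obtain v where v: "(\<phi> has_vector_derivative v) (at x within {a..b})" "norm v \<le> C"
      using E(2) by blast
    obtain s where s: "s > 0" "\<And>y. y \<in> {a..b} \<Longrightarrow> \<bar>y - x\<bar> < s \<Longrightarrow>
        norm (\<phi> y - \<phi> x - (y - x) *\<^sub>R v) \<le> \<epsilon> * \<bar>y - x\<bar>"
      using v(1) \<epsilon>(1) unfolding has_vector_derivative_def has_derivative_within_alt
        by (auto simp: real_norm_def)
    have "norm (\<phi> y - \<phi> x) \<le> (C + \<epsilon>) * \<bar>y - x\<bar>" if "y \<in> ball x s \<inter> {a..b}" for y
    proof -
      have "norm (\<phi> y - \<phi> x) \<le> norm (\<phi> y - \<phi> x - (y - x) *\<^sub>R v) + norm ((y - x) *\<^sub>R v)"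
        by (metis diff_add_cancel norm_triangle_ineq)
      also have "\<dots> \<le> \<epsilon> * \<bar>y - x\<bar> + \<bar>y - x\<bar> * C"
        using s(2)[of y] that v(2) by (intro add_mono) (auto simp: dist_real_def intro: mult_left_mono)
      finally show ?thesis by (simp add: algebra_simps)
    qed
    then show ?thesis using True s(1) by (intro exI[of _ "ball x s"]) auto
  next
    case False
    then show ?thesis using U by (intro exI[of _ "if x \<in> E then U else UNIV"]) auto
  qed
  then obtain \<gamma> where \<gamma>: "\<And>x. open (\<gamma> x)" "\<And>x. x \<in> \<gamma> x" "\<And>x. x \<in> E \<Longrightarrow> \<gamma> x \<subseteq> U"
    "\<And>x y. x \<in> {a..b} - E \<Longrightarrow> y \<in> \<gamma> x \<inter> {a..b} \<Longrightarrow> norm (\<phi> y - \<phi> x) \<le> (C + \<epsilon>) * \<bar>y - x\<bar>"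
    by metis
  have "gauge \<gamma>" using \<gamma> by (simp add: gauge_def)
  then obtain p where p: "p tagged_division_of {c..d}" "\<gamma> fine p"
    using fine_division_exists_real by metis
  have fin: "finite p" using p(1) by blast
  define p1 where "p1 = {(x, K) \<in> p. x \<in> E}"
  define p2 where "p2 = p - p1"
  let ?n = "\<lambda>K. norm (\<phi> (Sup K) - \<phi> (Inf K))"
  have K: "\<exists>u v. K = {u..v} \<and> u \<le> x \<and> x \<le> v \<and> c \<le> u \<and> v \<le> d" if xK: "(x, K) \<in> p" for x K
  proof -
    obtain u v where uv: "K = cbox u v" using tagged_division_ofD(4)[OF p(1) xK] by auto
    have "x \<in> K" "K \<subseteq> {c..d}" using tagged_division_ofD(2,3)[OF p(1) xK] by auto
    with uv show ?thesis by (intro exI[of _ u] exI[of _ v]) auto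
  qed
  have "\<phi> d - \<phi> c = (\<Sum>(x, K)\<in>p. \<phi> (Sup K) - \<phi> (Inf K))"
    using additive_tagged_division_1[OF cd(2) p(1), of \<phi>] by simp
  then have "norm (\<phi> d - \<phi> c) \<le> (\<Sum>(x, K)\<in>p. ?n K)"
    by (simp add: case_prod_beta norm_sum)
  also have "\<dots> = (\<Sum>(x, K)\<in>p1. ?n K) + (\<Sum>(x, K)\<in>p2. ?n K)"
    unfolding p2_def using fin by (subst sum.subset_diff[of p1 p]) (auto simp: p1_def add.commute)
  also have "(\<Sum>(x, K)\<in>p1. ?n K) < \<epsilon>"
  proof -
    have "p1 tagged_partial_division_of {c..d}"
      using p(1) tagged_partial_division_subset[of p "{c..d}" p1]
        unfolding tagged_division_of_def p1_def by auto
    from tagged_partial_division_of_Union_self[OF this]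
    have td: "p1 tagged_division_of \<Union> (snd ` p1)" .
    then have D: "(snd ` p1) division_of \<Union> (snd ` p1)" by (rule division_of_tagged_division)
    have sub: "\<Union> (snd ` p1) \<subseteq> U"
      using p(2) \<gamma>(3) unfolding p1_def fine_def by fastforce
    have sub': "\<Union> (snd ` p1) \<subseteq> {a..b}"
      using K cd unfolding p1_def by fastforce
    have "(\<Sum>K\<in>snd ` p1. Sup K - Inf K) = (\<Sum>K\<in>snd ` p1. measure lebesgue K)"
      using K by (intro sum.cong refl) (force simp: p1_def)
    also have "\<dots> = measure lebesgue (\<Union> (snd ` p1))" by (rule content_division[OF D])
    also have "\<dots> \<le> measure lebesgue U"
      using sub U(3) lmeasurable_division[OF D] by (intro measure_mono_fmeasurable)
        (auto simp: fmeasurableD)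
    also have "\<dots> < \<eta>" by (rule U(4))
    finally have "(\<Sum>K\<in>snd ` p1. ?n K) < \<epsilon>" by (rule \<eta>(2)[OF D sub'])
    moreover have "(\<Sum>(x, K)\<in>p1. ?n K) = (\<Sum>K\<in>snd ` p1. ?n K)"
    proof -
      \<comment> \<open>Absolute continuity speaks of sets of intervals, in which intervals repeated
        under several tags count once. Repeated intervals have empty interior, where the summand has
        to vanish: it does on a single point, and on the empty set, where \<open>Sup\<close> and
        \<open>Inf\<close> are unspecified, by this definition.\<close>
      let ?n' = "\<lambda>K. if K = {} then 0 else ?n K"
      have nonempty: "L \<noteq> {}" if "(x, L) \<in> p1" for x L
        using K[of x L] that unfolding p1_def by force
      have "(\<Sum>(x, K)\<in>p1. ?n' K) = (\<Sum>K\<in>snd ` p1. ?n' K)"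
      proof (rule sum.over_tagged_division_lemma[OF td])
        fix u v :: real assume "box u v = {}"
        then show "?n' (cbox u v) = 0" by (cases "u = v") auto
      qed
      moreover have "(\<Sum>(x, K)\<in>p1. ?n' K) = (\<Sum>(x, K)\<in>p1. ?n K)"
        using nonempty by (intro sum.cong) auto
      moreover have "(\<Sum>K\<in>snd ` p1. ?n' K) = (\<Sum>K\<in>snd ` p1. ?n K)"
        using nonempty by (intro sum.cong) auto
      ultimately show ?thesis by simp
    qed
    ultimately show ?thesis by simp
  qed
  also have "(\<Sum>(x, K)\<in>p2. ?n K) \<le> (\<Sum>(x, K)\<in>p2. (C + \<epsilon>) * measure lborel K)"
  proof (rule sum_mono, clarify)
    fix x L assume xK: "(x, L) \<in> p2"
    then have xKp: "(x, L) \<in> p" "x \<notin> E" by (auto simp: p2_def p1_def)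
    obtain u v where uv: "L = {u..v}" "u \<le> x" "x \<le> v" "c \<le> u" "v \<le> d" using K[OF xKp(1)] by blast
    have "L \<subseteq> \<gamma> x" using p(2) xKp(1) by (auto simp: fine_def)
    then have "u \<in> \<gamma> x" "v \<in> \<gamma> x" using uv by auto
    moreover have "x \<in> {a..b} - E" "u \<in> {a..b}" "v \<in> {a..b}" using xKp(2) uv cd by auto
    ultimately have "norm (\<phi> u - \<phi> x) \<le> (C + \<epsilon>) * \<bar>u - x\<bar>"
      "norm (\<phi> v - \<phi> x) \<le> (C + \<epsilon>) * \<bar>v - x\<bar>"
      using \<gamma>(4) by blast+
    moreover have "norm (\<phi> v - \<phi> u) \<le> norm (\<phi> v - \<phi> x) + norm (\<phi> u - \<phi> x)"
      using norm_triangle_ineq4[of "\<phi> v - \<phi> x" "\<phi> u - \<phi> x"] by simp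
    ultimately show "?n L \<le> (C + \<epsilon>) * measure lborel L"
      using uv by (simp add: algebra_simps)
  qed
  also have "\<dots> \<le> (\<Sum>(x, K)\<in>p. (C + \<epsilon>) * measure lborel K)"
    using fin \<open>0 \<le> C\<close> \<epsilon>(1) by (intro sum_mono2) (auto simp: p2_def)
  also have "\<dots> = (C + \<epsilon>) * (d - c)"
    using additive_content_tagged_division[of p c d] p(1) cd(2)
    by (simp add: case_prod_beta flip: sum_distrib_left)
  finally show "norm (\<phi> d - \<phi> c) \<le> C * (d - c) + \<epsilon>0"
    using \<epsilon>(2) by (simp add: algebra_simps)
qed

section \<open>Cramer's rule with uniform constants\<close>

lemma continuous_on_det [continuous_intros]:
  fixes A :: "'a::topological_space \<Rightarrow> real ^ 'n ^ 'n"
  assumes "continuous_on S A"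
  shows "continuous_on S (\<lambda>x. det (A x))"
  unfolding det_def using assms by (intro continuous_intros)

text \<open>The \<open>k\<close>-th coordinate of \<open>w\<close> in the basis of the vectors
  \<open>v i\<close>, taken as rows. The explicit quotient depends continuously on \<open>v\<close>
  and \<open>w\<close>, from which the measurability of the new controls will follow.\<close>

definition cramer_coeff :: "('n::finite \<Rightarrow> real ^ 'n) \<Rightarrow> real ^ 'n \<Rightarrow> 'n \<Rightarrow> real" where
  "cramer_coeff v w k = det (\<chi> i. if i = k then w else v i) / det (\<chi> i. v i)"

lemma cramer_coeff_sum:
  fixes v :: "'n::finite \<Rightarrow> real ^ 'n"
  assumes "det (\<chi> i. v i) \<noteq> 0"
  shows "(\<Sum>k\<in>UNIV. cramer_coeff v w k *\<^sub>R v k) = w"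
proof -
  let ?B = "(\<chi> i. v i) :: real ^ 'n ^ 'n"
  have "invertible (transpose ?B)" using assms by (simp add: invertible_det_nz)
  then obtain x where "transpose ?B *v x = w"
    unfolding invertible_def by (metis matrix_vector_mul_assoc matrix_vector_mul_lid)
  then have w: "w = (\<Sum>i\<in>UNIV. x $ i *s row i ?B)"
    by (simp add: matrix_mult_sum column_transpose)
  have row: "row i ?B = v i" for i by (simp add: row_def vec_eq_iff)
  have "det (\<chi> i. if i = k then w else v i) = x $ k * det ?B" for k
    using cramer_lemma_transpose[of k x ?B] by (simp only: row w[unfolded row, symmetric])
  then have "cramer_coeff v w k = x $ k" for k using assms by (simp add: cramer_coeff_def)
  then show ?thesis using w row by (simp add: scalar_mult_eq_scaleR)
qed

lemma norm_matrix_le: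
  fixes A :: "real ^ 'n ^ 'm"
  assumes "\<And>i. norm (A $ i) \<le> b"
  shows "norm A \<le> real CARD('m) * b"
proof -
  have "norm A \<le> (\<Sum>i\<in>UNIV. norm (A $ i))" unfolding norm_vec_def by (rule L2_set_le_sum) simp
  also have "\<dots> \<le> real CARD('m) * b" using assms sum_bounded_above[of UNIV "\<lambda>i. norm (A $ i)" b] by simp
  finally show ?thesis .
qed

text \<open>The determinant is uniformly continuous and bounded on a compact ball of matrices, so
  \<epsilon> and \<open>L\<close> depend on \<open>M\<close>, \<open>c0\<close> and the dimension
  only. A perturbed determinant exceeds \<open>c0 / 2\<close> in absolute value, which gives
  \<open>L = 2 * D / c0\<close>.\<close>

lemma cramer_coeff_perturbation:
  fixes M c0 :: real
  assumes "0 < c0" "0 \<le> M"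
  shows "\<exists>\<epsilon>>0. \<exists>L\<ge>0. \<forall>v v' :: 'n::finite \<Rightarrow> real ^ 'n.
    (\<forall>i. norm (v i) \<le> M) \<and> c0 \<le> \<bar>det (\<chi> i. v i)\<bar> \<and> (\<forall>i. norm (v' i - v i) \<le> \<epsilon>) \<longrightarrow>
    det (\<chi> i. v' i) \<noteq> 0 \<and> (\<forall>w k. \<bar>cramer_coeff v' w k\<bar> \<le> L * norm w)"
proof -
  \<comment> \<open>The summand 1 leaves room for perturbed rows, since \<epsilon> is at most 1, and
    for a unit vector in place of a row.\<close>
  let ?R = "real CARD('n) * (M + 1)" and ?det = "det :: real ^ 'n ^ 'n \<Rightarrow> real"
  let ?m = "\<lambda>v. (\<chi> i. v i) :: real ^ 'n ^ 'n"
  have cont: "continuous_on (cball 0 ?R) ?det" by (intro continuous_intros)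
  have comp: "compact (cball 0 ?R :: (real ^ 'n ^ 'n) set)" by simp
  have "uniformly_continuous_on (cball 0 ?R) ?det" by (rule compact_uniformly_continuous[OF cont comp])
  then obtain e where e: "e > 0" "\<And>A B. A \<in> cball 0 ?R \<Longrightarrow> B \<in> cball 0 ?R \<Longrightarrow> dist B A < e \<Longrightarrow>
      dist (?det B) (?det A) < c0 / 2"
    using \<open>0 < c0\<close> unfolding uniformly_continuous_on_def by (metis half_gt_zero)
  have "bounded (?det ` cball 0 ?R)" using compact_continuous_image[OF cont comp] compact_imp_bounded
    by blast
  then obtain D where D: "D > 0" "\<And>A. A \<in> cball 0 ?R \<Longrightarrow> \<bar>?det A\<bar> \<le> D"
    unfolding bounded_pos by auto
  define \<epsilon> where "\<epsilon> = min 1 (e / (2 * real CARD('n)))"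
  have \<epsilon>: "0 < \<epsilon>" "\<epsilon> \<le> 1" "real CARD('n) * \<epsilon> < e"
  proof -
    have "real CARD('n) * \<epsilon> \<le> real CARD('n) * (e / (2 * real CARD('n)))"
      unfolding \<epsilon>_def by (intro mult_left_mono) auto
    also have "\<dots> < e" using e(1) by simp
    finally show "real CARD('n) * \<epsilon> < e" .
  qed (use e(1) in \<open>auto simp: \<epsilon>_def\<close>)
  have "?det (?m v') \<noteq> 0 \<and> (\<forall>w k. \<bar>cramer_coeff v' w k\<bar> \<le> 2 * D / c0 * norm w)"
    if v: "\<And>i. norm (v i) \<le> M" and det: "c0 \<le> \<bar>?det (?m v)\<bar>" and v': "\<And>i. norm (v' i - v i) \<le> \<epsilon>" for v v'
  proof -
    have v'M: "norm (v' i) \<le> M + 1" for i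
      using norm_triangle_sub[of "v' i" "v i"] v[of i] v'[of i] \<epsilon>(2) by linarith
    have "norm (?m v) \<le> ?R" "norm (?m v') \<le> ?R"
      using v v'M by (auto intro!: norm_matrix_le intro: add_increasing2 order_trans[OF v])
    moreover have "norm (?m v' - ?m v) \<le> real CARD('n) * \<epsilon>"
      using v' by (intro norm_matrix_le) simp
    ultimately have "dist (?det (?m v')) (?det (?m v)) < c0 / 2"
      using \<epsilon>(3) by (intro e(2)) (auto simp: dist_norm)
    then have d': "c0 / 2 < \<bar>?det (?m v')\<bar>"
      using det unfolding dist_real_def by (smt (verit) field_sum_of_halves)
    \<comment> \<open>By homogeneity in row \<open>k\<close> the vector \<open>w\<close> may be
      normalised, which places the matrix in the ball on which \<open>D\<close> bounds the
      determinant.\<close>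
    have num: "\<bar>?det (?m (\<lambda>i. if i = k then w else v' i))\<bar> \<le> D * norm w" for w k
    proof (cases "w = 0")
      case True
      show ?thesis unfolding True using det_row_0[of k v'] by simp
    next
      case False
      let ?u = "(1 / norm w) *\<^sub>R w"
      have "?m (\<lambda>i. if i = k then w else v' i) = ?m (\<lambda>i. if i = k then norm w *s ?u else v' i)"
        using False by (auto simp: vec_eq_iff scalar_mult_eq_scaleR)
      then have "?det (?m (\<lambda>i. if i = k then w else v' i)) = norm w * ?det (?m (\<lambda>i.
        if i = k then ?u else v' i))"
        using det_row_mul[of k "norm w" "\<lambda>i. ?u" v'] by simp
      moreover have "\<bar>?det (?m (\<lambda>i. if i = k then ?u else v' i))\<bar> \<le> D"
      proof (rule D(2))
        have "norm (?m (\<lambda>i. if i = k then ?u else v' i)) \<le> ?R"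
          using v'M False \<open>0 \<le> M\<close> by (intro norm_matrix_le) auto
        then show "?m (\<lambda>i. if i = k then ?u else v' i) \<in> cball 0 ?R" by simp
      qed
      ultimately show ?thesis by (simp add: abs_mult mult.commute[of D] mult_left_mono)
    qed
    have "\<bar>cramer_coeff v' w k\<bar> \<le> 2 * D / c0 * norm w" for w k
    proof -
      have "\<bar>cramer_coeff v' w k\<bar> \<le> D * norm w / (c0 / 2)"
        unfolding cramer_coeff_def abs_divide
        using num[of k w] d' \<open>0 < c0\<close> D(1) by (intro frac_le) auto
      then show ?thesis by (simp add: mult_ac)
    qed
    moreover have "?det (?m v') \<noteq> 0" using d' \<open>0 < c0\<close> by auto
    ultimately show ?thesis by blast
  qed
  moreover have "0 \<le> 2 * D / c0" using D(1) \<open>0 < c0\<close> by simp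
  ultimately show ?thesis using \<epsilon>(1) by blast
qed

section \<open>Passing a curve from one system to the other\<close>

lemma curve_class_transfer:
  fixes Y Z :: "nat \<Rightarrow> real ^ 'p \<Rightarrow> real ^ 'p"
  assumes \<phi>: "\<phi> \<in> curve_class \<Omega> n r Y \<delta>" and \<delta>: "0 < \<delta>" "\<delta> \<le> 1" and "0 \<le> L" "0 \<le> E"
    and \<I>: "\<And>k :: 'p. \<I> k \<in> multiindices n r"
    and V: "\<phi> ` {0..1} \<subseteq> V"
    and contY: "\<And>I. I \<in> multiindices n r \<Longrightarrow> continuous_on V (iter_bracket Y I)"
    and contZ: "\<And>I. I \<in> multiindices n r \<Longrightarrow> continuous_on V (iter_bracket Z I)"
    and det: "\<And>x. x \<in> V \<Longrightarrow> det (\<chi> k. iter_bracket Z (\<I> k) x) \<noteq> 0"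
    and coeff: "\<And>x w k. x \<in> V \<Longrightarrow> \<bar>cramer_coeff (\<lambda>k. iter_bracket Z (\<I> k) x) w k\<bar> \<le> L * norm w"
    and diff: "\<And>I x. I \<in> multiindices n r \<Longrightarrow> x \<in> V \<Longrightarrow>
      norm (iter_bracket Y I x - iter_bracket Z I x) \<le> E * \<delta> ^ (r - weight I)"
  shows "\<phi> \<in> curve_class \<Omega> n r Z ((1 + real (card (multiindices n r)) * real CARD('p) * L * E) * \<delta>)"
proof -
  let ?MI = "multiindices n r" and ?D = "1 + real (card (multiindices n r)) * real CARD('p) * L * E"
  let ?T = "{0..1} :: real set"
  let ?YI = "\<lambda>I t. iter_bracket Y I (\<phi> t)" and ?ZI = "\<lambda>I t. iter_bracket Z I (\<phi> t)"
  have fin: "finite ?MI" by (rule finite_multiindices)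
  obtain a where a: "\<And>I. I \<in> ?MI \<Longrightarrow> a I \<in> borel_measurable (lebesgue_on ?T)"
    "\<And>I t. I \<in> ?MI \<Longrightarrow> t \<in> ?T \<Longrightarrow> \<bar>a I t\<bar> \<le> \<delta> ^ weight I"
    "AE t in lebesgue_on ?T. (\<phi> has_vector_derivative (\<Sum>I\<in>?MI. a I t *\<^sub>R ?YI I t)) (at t within ?T)"
    and im: "\<phi> ` ?T \<subseteq> \<Omega>" and ac: "abs_continuous_on ?T \<phi>"
    using \<phi> unfolding curve_class_def by blast
  have D1: "1 \<le> ?D" using \<open>0 \<le> L\<close> \<open>0 \<le> E\<close> by simp
  define g where "g I k t = cramer_coeff (\<lambda>k. ?ZI (\<I> k) t) (?YI I t - ?ZI I t) k" for I k t
  have g_sum: "(\<Sum>k\<in>UNIV. g I k t *\<^sub>R ?ZI (\<I> k) t) = ?YI I t - ?ZI I t" if "t \<in> ?T" for I t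
    unfolding g_def using V that by (intro cramer_coeff_sum det) auto
  have g_bound: "\<bar>g I k t\<bar> \<le> L * (E * \<delta> ^ (r - weight I))" if "I \<in> ?MI" "t \<in> ?T" for I k t
  proof -
    have "\<phi> t \<in> V" using V that by auto
    then have "\<bar>g I k t\<bar> \<le> L * norm (?YI I t - ?ZI I t)" unfolding g_def by (rule coeff)
    also have "\<dots> \<le> L * (E * \<delta> ^ (r - weight I))"
      using diff[OF that(1) \<open>\<phi> t \<in> V\<close>] \<open>0 \<le> L\<close> by (rule mult_left_mono)
    finally show ?thesis .
  qed
  have c\<phi>: "continuous_on ?T \<phi>" using ac by (rule abs_continuous_on_continuous)
  have cY: "continuous_on ?T (?YI I)" and cZ: "continuous_on ?T (?ZI I)" if "I \<in> ?MI" for I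
    using continuous_on_compose2[OF contY[OF that] c\<phi> V] continuous_on_compose2[OF contZ[OF that] c\<phi> V]
      by auto
  have g_cont: "continuous_on ?T (g I k)" if "I \<in> ?MI" for I k
  proof -
    have "continuous_on ?T (\<lambda>t. if i = k then ?YI I t - ?ZI I t else ?ZI (\<I> i) t)" for i
      using cY[OF that] cZ[OF that] cZ[OF \<I>] by (cases "i = k") (auto intro: continuous_on_diff)
    then show ?thesis unfolding g_def cramer_coeff_def
      using det V cZ[OF \<I>] by (intro continuous_intros) auto
  qed
  then have g_meas: "g I k \<in> borel_measurable (lebesgue_on ?T)" if "I \<in> ?MI" for I k
    using that by (intro continuous_imp_measurable_on_sets_lebesgue) auto
  \<comment> \<open>The coordinate with index \<open>k\<close> is charged to the commutator
    \<open>\<I> k\<close>; the sum over the fibre of \<open>\<I>\<close> treats all multi-indices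
    \<open>J\<close> alike, including those that \<open>\<I>\<close> misses.\<close>
  define b where "b J t = a J t + (\<Sum>I\<in>?MI. a I t * (\<Sum>k | \<I> k = J. g I k t))" for J t
  have b_meas: "b J \<in> borel_measurable (lebesgue_on ?T)" if "J \<in> ?MI" for J
    unfolding b_def using that a(1) g_meas
    by (intro borel_measurable_add borel_measurable_sum borel_measurable_times) auto
  have b_bound: "\<bar>b J t\<bar> \<le> (?D * \<delta>) ^ weight J" if J: "J \<in> ?MI" and t: "t \<in> ?T" for J t
  proof -
    have wJ: "weight J \<le> r" "1 \<le> weight J"
      using J length_le_weight[of J]
        by (auto simp: multiindices_def Suc_le_eq simp flip: length_greater_0_conv)
    have summand: "\<bar>a I t * (\<Sum>k | \<I> k = J. g I k t)\<bar> \<le> real CARD('p) * L * E * \<delta> ^ weight J"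
      if I: "I \<in> ?MI" for I
    proof -
      have "weight I \<le> r" using I by (simp add: multiindices_def)
      have "\<bar>\<Sum>k | \<I> k = J. g I k t\<bar> \<le> (\<Sum>k | \<I> k = J. \<bar>g I k t\<bar>)" by (rule sum_abs)
      also have "\<dots> \<le> (\<Sum>k\<in>UNIV. \<bar>g I k t\<bar>)" by (intro sum_mono2) auto
      also have "\<dots> \<le> real CARD('p) * (L * (E * \<delta> ^ (r - weight I)))"
        using sum_bounded_above[of UNIV "\<lambda>k. \<bar>g I k t\<bar>"] g_bound[OF I t] by simp
      finally have "\<bar>a I t * (\<Sum>k | \<I> k = J. g I k t)\<bar>
          \<le> \<delta> ^ weight I * (real CARD('p) * (L * (E * \<delta> ^ (r - weight I))))"
        using a(2)[OF I t] \<delta> unfolding abs_mult by (intro mult_mono) auto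
      also have "\<dots> = real CARD('p) * L * E * \<delta> ^ r"
        using \<open>weight I \<le> r\<close> power_add[of \<delta> "weight I" "r - weight I"] by simp
      also have "\<dots> \<le> real CARD('p) * L * E * \<delta> ^ weight J"
        using \<delta> wJ \<open>0 \<le> L\<close> \<open>0 \<le> E\<close> by (intro mult_left_mono power_decreasing) auto
      finally show ?thesis .
    qed
    have "\<bar>b J t\<bar> \<le> \<bar>a J t\<bar> + \<bar>\<Sum>I\<in>?MI. a I t * (\<Sum>k | \<I> k = J. g I k t)\<bar>"
      unfolding b_def by (rule abs_triangle_ineq)
    also have "\<dots> \<le> \<delta> ^ weight J + real (card ?MI) * (real CARD('p) * L * E * \<delta> ^ weight J)"
      using a(2)[OF J t] summand order_trans[OF sum_abs sum_bounded_above[of ?MI "\<lambda>I. \<bar>a I t * (\<Sum>k | \<I> k = J. g I k t)\<bar>"]]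
      by (intro add_mono) auto
    also have "\<dots> = ?D * \<delta> ^ weight J" by (simp add: algebra_simps)
    \<comment> \<open>A constant factor in front of the power moves into the radius because weights
      are at least 1 and \<open>?D\<close> is at least 1.\<close>
    also have "\<dots> \<le> ?D ^ weight J * \<delta> ^ weight J"
      using power_increasing[OF wJ(2) D1] \<delta> by (intro mult_right_mono) auto
    finally show ?thesis by (simp add: power_mult_distrib)
  qed
  have b_sum: "(\<Sum>J\<in>?MI. b J t *\<^sub>R ?ZI J t) = (\<Sum>I\<in>?MI. a I t *\<^sub>R ?YI I t)" if t: "t \<in> ?T" for t
  proof -
    have "(\<Sum>J\<in>?MI. (\<Sum>k | \<I> k = J. g I k t) *\<^sub>R ?ZI J t) = ?YI I t - ?ZI I t" for I
    proof -
      have "(\<Sum>J\<in>?MI. (\<Sum>k | \<I> k = J. g I k t) *\<^sub>R ?ZI J t)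
          = (\<Sum>J\<in>?MI. \<Sum>k | k \<in> UNIV \<and> \<I> k = J. g I k t *\<^sub>R ?ZI (\<I> k) t)"
        by (simp add: scaleR_sum_left)
      also have "\<dots> = (\<Sum>k\<in>UNIV. g I k t *\<^sub>R ?ZI (\<I> k) t)"
        using fin \<I> by (intro sum.group) auto
      finally show ?thesis using g_sum[OF t] by simp
    qed
    note inner = this
    have "(\<Sum>J\<in>?MI. b J t *\<^sub>R ?ZI J t) = (\<Sum>J\<in>?MI. a J t *\<^sub>R ?ZI J t) +
        (\<Sum>J\<in>?MI. \<Sum>I\<in>?MI. a I t *\<^sub>R ((\<Sum>k | \<I> k = J. g I k t) *\<^sub>R ?ZI J t))"
      unfolding b_def
      by (simp add: scaleR_add_left scaleR_sum_left scaleR_sum_right sum_distrib_left sum.distrib)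
    also have "(\<Sum>J\<in>?MI. \<Sum>I\<in>?MI. a I t *\<^sub>R ((\<Sum>k | \<I> k = J. g I k t) *\<^sub>R ?ZI J t))
        = (\<Sum>I\<in>?MI. a I t *\<^sub>R (?YI I t - ?ZI I t))"
      by (subst sum.swap) (simp only: inner flip: scaleR_sum_right)
    finally show ?thesis by (simp add: scaleR_diff_right sum_subtractf)
  qed
  have "AE t in lebesgue_on ?T. (\<phi> has_vector_derivative (\<Sum>J\<in>?MI. b J t *\<^sub>R ?ZI J t)) (at t within ?T)"
    by (rule AE_lebesgue_on_mono[OF a(3)]) (simp add: b_sum)
  then show ?thesis
    using im ac b_meas b_bound unfolding curve_class_def by blast
qed

text \<open>For \<delta> at most 1 every control is at most \<delta>, as weights are at least 1; so
  the speed is O(\<delta>). The fields are bounded on all of \<Omega>, where the curve lives by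
  definition, so the estimate holds at once up to time 1.\<close>

lemma curve_class_growth:
  fixes Y :: "nat \<Rightarrow> real ^ 'p \<Rightarrow> real ^ 'p"
  assumes \<phi>: "\<phi> \<in> curve_class \<Omega> n r Y \<delta>" and \<delta>: "0 < \<delta>" "\<delta> \<le> 1" and "0 \<le> C"
    and bound: "\<And>I x. I \<in> multiindices n r \<Longrightarrow> x \<in> \<Omega> \<Longrightarrow> norm (iter_bracket Y I x) \<le> C"
    and t: "t \<in> {0..1}"
  shows "dist (\<phi> t) (\<phi> 0) \<le> real (card (multiindices n r)) * C * \<delta>"
proof -
  let ?MI = "multiindices n r" and ?T = "{0..1} :: real set"
  obtain a where a: "\<And>I t. I \<in> ?MI \<Longrightarrow> t \<in> ?T \<Longrightarrow> \<bar>a I t\<bar> \<le> \<delta> ^ weight I"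
    "AE t in lebesgue_on ?T. (\<phi> has_vector_derivative (\<Sum>I\<in>?MI. a I t *\<^sub>R iter_bracket Y I (\<phi> t)))
      (at t within ?T)"
    and im: "\<phi> ` ?T \<subseteq> \<Omega>" and ac: "abs_continuous_on ?T \<phi>"
    using \<phi> unfolding curve_class_def by blast
  have "norm (\<Sum>I\<in>?MI. a I t *\<^sub>R iter_bracket Y I (\<phi> t)) \<le> real (card ?MI) * (\<delta> * C)" if t: "t \<in> ?T" for t
  proof (rule sum_norm_bound)
    fix I assume I: "I \<in> ?MI"
    then have "1 \<le> weight I"
      using length_le_weight[of I]
        by (auto simp: multiindices_def Suc_le_eq simp flip: length_greater_0_conv)
    then have "\<delta> ^ weight I \<le> \<delta>" using \<delta> power_decreasing[of 1 "weight I" \<delta>] by simp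
    moreover have "\<phi> t \<in> \<Omega>" using im t by auto
    ultimately show "norm (a I t *\<^sub>R iter_bracket Y I (\<phi> t)) \<le> \<delta> * C"
      using a(1)[OF I t] bound[OF I] \<delta> by (auto intro!: mult_mono)
  qed
  then have "AE t in lebesgue_on ?T. \<exists>v. (\<phi> has_vector_derivative v) (at t within ?T) \<and> norm v \<le>
    real (card ?MI) * (\<delta> * C)"
    by (intro AE_lebesgue_on_mono[OF a(2)]) blast
  then have "norm (\<phi> t - \<phi> 0) \<le> real (card ?MI) * (\<delta> * C) * (t - 0)"
    using \<delta> \<open>0 \<le> C\<close> t by (intro abs_continuous_on_growth[OF ac]) auto
  also have "\<dots> \<le> real (card ?MI) * (\<delta> * C) * 1"
    using \<delta> \<open>0 \<le> C\<close> t by (intro mult_left_mono) auto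
  finally show ?thesis by (simp add: dist_norm mult_ac)
qed

section \<open>Uniform estimates\<close>

lemma Ck_flatI:
  assumes "\<And>\<alpha> x. length \<alpha> < k \<Longrightarrow> x \<in> U \<Longrightarrow> pderivs \<alpha> f differentiable (at x)"
    and "\<And>\<alpha>. length \<alpha> = k \<Longrightarrow> continuous_on U (pderivs \<alpha> f)"
    and "\<And>\<alpha> x. length \<alpha> \<le> k \<Longrightarrow> x \<in> U \<Longrightarrow> \<bar>pderivs \<alpha> f x\<bar> \<le> M"
  shows "Ck_flat d U 0 M k f"
  using assms
proof (induction k arbitrary: f)
  case 0
  from 0(2,3)[of "[]"] show ?case by simp
next
  case (Suc k)
  have "Ck_flat d U 0 M k (pderiv1 j f)" for j
  proof (rule Suc.IH)
    show "pderivs \<alpha> (pderiv1 j f) differentiable (at x)" if "length \<alpha> < k" "x \<in> U" for \<alpha> x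
      using Suc.prems(1)[of "\<alpha> @ [j]" x] that by (simp add: pderivs_append)
    show "continuous_on U (pderivs \<alpha> (pderiv1 j f))" if "length \<alpha> = k" for \<alpha>
      using Suc.prems(2)[of "\<alpha> @ [j]"] that by (simp add: pderivs_append)
    show "\<bar>pderivs \<alpha> (pderiv1 j f) x\<bar> \<le> M" if "length \<alpha> \<le> k" "x \<in> U" for \<alpha> x
      using Suc.prems(3)[of "\<alpha> @ [j]" x] that by (simp add: pderivs_append)
  qed
  then show ?case using Suc.prems(1,3)[of "[]"] by simp
qed

text \<open>The supremum bounds its members only if it is finite. That is due to the continuous
  extensions to the compact closure and to the finiteness of the set of lists.\<close>

lemma Ck_norm_bound:
  fixes \<Omega> :: "(real ^ 'p) set"
  assumes "bounded \<Omega>" "Ck_closure k \<Omega> f" "length \<alpha> \<le> k" "x \<in> \<Omega>"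
  shows "\<bar>pderivs \<alpha> f x\<bar> \<le> Ck_norm k \<Omega> f"
proof -
  let ?A = "{\<alpha> :: 'p list. length \<alpha> \<le> k}"
  have fin: "finite ?A" using finite_lists_length_le[of "UNIV :: 'p set" k] by simp
  have "bdd_above ((\<lambda>x. \<bar>pderivs \<beta> f x\<bar>) ` \<Omega>)" if "\<beta> \<in> ?A" for \<beta>
  proof -
    obtain g where g: "continuous_on (closure \<Omega>) g" "\<forall>x\<in>\<Omega>. g x = pderivs \<beta> f x"
      using assms(2) \<open>\<beta> \<in> ?A\<close> unfolding Ck_closure_def by blast
    have "bounded (g ` closure \<Omega>)"
      using compact_continuous_image[OF g(1)] assms(1) compact_imp_bounded by auto
    then obtain B where "\<And>x. x \<in> closure \<Omega> \<Longrightarrow> \<bar>g x\<bar> \<le> B" unfolding bounded_iff by auto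
    then show ?thesis using g(2) closure_subset[of \<Omega>] by (intro bdd_aboveI2[of _ _ B]) (metis subsetD)
  qed
  then have "bdd_above (\<Union>\<beta>\<in>?A. (\<lambda>x. \<bar>pderivs \<beta> f x\<bar>) ` \<Omega>)"
    by (simp add: fin)
  also have "(\<Union>\<beta>\<in>?A. (\<lambda>x. \<bar>pderivs \<beta> f x\<bar>) ` \<Omega>) = (\<lambda>(\<beta>, x). \<bar>pderivs \<beta> f x\<bar>) ` (?A \<times> \<Omega>)"
    by auto
  finally show ?thesis
    unfolding Ck_norm_def using assms(3,4) cSUP_upper[of "(\<alpha>, x)" "?A \<times> \<Omega>" "\<lambda>(\<alpha>, x). \<bar>pderivs \<alpha> f x\<bar>"]
    by simp
qed

lemma Ck_closure_Ck_flat: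
  assumes "bounded \<Omega>" "Ck_closure k \<Omega> f" "Ck_norm k \<Omega> f \<le> K"
  shows "Ck_flat d \<Omega> 0 K k f"
proof (rule Ck_flatI)
  show "continuous_on \<Omega> (pderivs \<alpha> f)" if "length \<alpha> = k" for \<alpha>
    using assms(2) that closure_subset[of \<Omega>] unfolding Ck_closure_def
    by (metis continuous_on_cong continuous_on_subset order_refl)
  show "\<bar>pderivs \<alpha> f x\<bar> \<le> K" if "length \<alpha> \<le> k" "x \<in> \<Omega>" for \<alpha> x
    using Ck_norm_bound[OF assms(1,2) that] assms(3) by linarith
qed (use assms(2) in \<open>auto simp: Ck_closure_def\<close>)

text \<open>An open set has no isolated points, so each point of its closure is a limit point and
  the limit is unique.\<close>

lemma closure_extension_eq:
  fixes \<Omega> :: "(real ^ 'p) set"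
  assumes "open \<Omega>" "continuous_on (closure \<Omega>) g" "\<And>x. x \<in> \<Omega> \<Longrightarrow> g x = f x" "z \<in> closure \<Omega>"
  shows "closure_extension \<Omega> f z = g z"
proof -
  have "z islimpt \<Omega>"
    using assms(1,4) interior_limit_point[of z \<Omega>] by (auto simp: closure_def interior_open)
  then have nt: "\<not> trivial_limit (at z within \<Omega>)" by (simp add: trivial_limit_within)
  have "(g \<longlongrightarrow> g z) (at z within closure \<Omega>)"
    using assms(2,4) by (simp add: continuous_on)
  then have "(g \<longlongrightarrow> g z) (at z within \<Omega>)"
    using tendsto_within_subset closure_subset by blast
  then have "(f \<longlongrightarrow> g z) (at z within \<Omega>)"
    by (rule Lim_transform_eventually) (auto simp: eventually_at_filter assms(3))
  then show ?thesis unfolding closure_extension_def using nt by (intro tendsto_Lim)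
qed

lemma continuity_modulus_bound:
  fixes \<Omega> :: "(real ^ 'p) set"
  assumes "open \<Omega>" "bounded \<Omega>" "continuous_on (closure \<Omega>) g" "\<And>x. x \<in> \<Omega> \<Longrightarrow> g x = f x"
    and "x \<in> \<Omega>" "y \<in> \<Omega>"
  shows "\<bar>f x - f y\<bar> \<le> continuity_modulus \<Omega> f (dist x y)"
proof -
  let ?P = "{(u, v). u \<in> closure \<Omega> \<and> v \<in> closure \<Omega> \<and> dist u v \<le> dist x y}"
  let ?h = "\<lambda>(u, v). \<bar>closure_extension \<Omega> f u - closure_extension \<Omega> f v\<bar>"
  have ext: "closure_extension \<Omega> f z = g z" if "z \<in> closure \<Omega>" for z
    using closure_extension_eq[OF assms(1,3,4) that] by simp
  have "bounded (g ` closure \<Omega>)"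
    using compact_continuous_image[OF assms(3)] assms(2) compact_imp_bounded by auto
  then obtain B where B: "\<And>x. x \<in> closure \<Omega> \<Longrightarrow> \<bar>g x\<bar> \<le> B" unfolding bounded_iff by auto
  have "?h q \<le> B + B" if "q \<in> ?P" for q
    using that B[of "fst q"] B[of "snd q"] ext by (auto simp: case_prod_beta)
  then have bdd: "bdd_above (?h ` ?P)" by (rule bdd_aboveI2)
  have xy: "x \<in> closure \<Omega>" "y \<in> closure \<Omega>" using assms(5,6) closure_subset by auto
  then have "?h (x, y) \<le> (SUP q\<in>?P. ?h q)"
    by (intro cSUP_upper[OF _ bdd]) simp
  then show ?thesis using ext xy assms(4-6) by (simp add: continuity_modulus_def)
qed

text \<open>The maximum over finitely many choices is attained, and it is nonnegative, so the
  infimum really is a lower bound at \<open>x\<close>. The choice \<open>\<I>\<close> varies with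
  \<open>x\<close>; only \<open>c0\<close> is uniform.\<close>

lemma max_det_witness:
  fixes X :: "nat \<Rightarrow> real ^ 'p \<Rightarrow> real ^ 'p"
  assumes "r \<ge> 2" "c0 \<le> (INF x\<in>S. max_det n r X x)" "x \<in> S"
  shows "\<exists>\<I>. (\<forall>k. \<I> k \<in> multiindices n r) \<and> c0 \<le> \<bar>det (\<chi> k. iter_bracket X (\<I> k) x)\<bar>"
proof -
  let ?F = "{\<I> :: 'p \<Rightarrow> nat list. \<forall>k. \<I> k \<in> multiindices n r}"
  have fin: "finite ?F"
    using finite_set_of_finite_funs[of "UNIV :: 'p set" "multiindices n r"] finite_multiindices by simp
  obtain J where "J \<in> multiindices n r" using multiindices_nonempty[OF assms(1)] by blast
  then have ne: "?F \<noteq> {}" by (auto intro: exI[of _ "\<lambda>_. J"])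
  have mem: "max_det n r X y \<in> (\<lambda>\<I>. \<bar>det (\<chi> k. iter_bracket X (\<I> k) y)\<bar>) ` ?F" for y
    unfolding max_det_def using fin ne by (intro Max_in) auto
  have "0 \<le> max_det n r X y" for y using mem[of y] by (metis (no_types, lifting) imageE abs_ge_zero)
  then have "bdd_below (max_det n r X ` S)" by (intro bdd_belowI2)
  then have "(INF x\<in>S. max_det n r X x) \<le> max_det n r X x" using assms(3) by (rule cINF_lower)
  moreover obtain \<I> where "\<I> \<in> ?F" "max_det n r X x = \<bar>det (\<chi> k. iter_bracket X (\<I> k) x)\<bar>"
    using mem[of x] by blast
  ultimately show ?thesis using assms(2) by (intro exI[of _ \<I>]) auto
qed

section \<open>Constants common to all multi-indices\<close>

lemma finite_uniform_bound:
  assumes "finite A" "\<And>a. a \<in> A \<Longrightarrow> \<exists>C\<ge>0::real. P a C"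
    and "\<And>a C C'. P a C \<Longrightarrow> 0 \<le> C \<Longrightarrow> C \<le> C' \<Longrightarrow> P a C'"
  shows "\<exists>C\<ge>0. \<forall>a\<in>A. P a C"
  using assms(1,2)
proof (induction A rule: finite_induct)
  case (insert a A)
  then obtain C D where "0 \<le> C" "P a C" "0 \<le> D" "\<forall>a\<in>A. P a D" by blast
  then show ?case using assms(3) by (intro exI[of _ "max C D"]) (auto simp: le_max_iff_disj)
qed auto

lemma brackets_bound:
  assumes "0 \<le> M" "r \<le> s"
  shows "\<exists>C\<ge>0. \<forall>I\<in>multiindices n r. \<forall>U d (Y :: nat \<Rightarrow> real ^ 'p \<Rightarrow> real ^ 'p). unit_gauge U d \<longrightarrow>
     fields_bounded d U M s {..n} Y \<longrightarrow>
     (\<forall>j. Ck_flat d U 0 C (s - weight I) (\<lambda>x. iter_bracket Y I x $ j))"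
proof (rule finite_uniform_bound[OF finite_multiindices])
  fix I assume "I \<in> multiindices n r"
  then have I: "I \<noteq> []" "weight I \<le> s" "set I \<subseteq> {..n}" using assms(2) by (auto simp: multiindices_def)
  show "\<exists>C\<ge>0. \<forall>U d (Y :: nat \<Rightarrow> real ^ 'p \<Rightarrow> real ^ 'p). unit_gauge U d \<longrightarrow>
     fields_bounded d U M s {..n} Y \<longrightarrow>
     (\<forall>j. Ck_flat d U 0 C (s - weight I) (\<lambda>x. iter_bracket Y I x $ j))"
    by (rule Ck_flat_iter_bracket[OF I assms(1)])
next
  fix I and C C' :: real
  assume *: "\<forall>U d (Y :: nat \<Rightarrow> real ^ 'p \<Rightarrow> real ^ 'p). unit_gauge U d \<longrightarrow>
     fields_bounded d U M s {..n} Y \<longrightarrow>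
     (\<forall>j. Ck_flat d U 0 C (s - weight I) (\<lambda>x. iter_bracket Y I x $ j))" and C: "0 \<le> C" "C \<le> C'"
  show "\<forall>U d (Y :: nat \<Rightarrow> real ^ 'p \<Rightarrow> real ^ 'p). unit_gauge U d \<longrightarrow>
     fields_bounded d U M s {..n} Y \<longrightarrow>
     (\<forall>j. Ck_flat d U 0 C' (s - weight I) (\<lambda>x. iter_bracket Y I x $ j))"
  proof (intro allI impI)
    fix U d and Y :: "nat \<Rightarrow> real ^ 'p \<Rightarrow> real ^ 'p" and j
    assume h: "unit_gauge U d" "fields_bounded d U M s {..n} Y"
    then have "Ck_flat d U 0 C (s - weight I) (\<lambda>x. iter_bracket Y I x $ j)" using * by blast
    then show "Ck_flat d U 0 C' (s - weight I) (\<lambda>x. iter_bracket Y I x $ j)"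
      by (rule Ck_flat_mono[OF _ C(2,1) order_refl order_refl unit_gaugeD(2)[OF h(1)]])
  qed
qed

lemma brackets_diff_bound:
  assumes "0 \<le> M" "r \<le> s"
  shows "\<exists>C\<ge>0. \<forall>I\<in>multiindices n r. \<forall>U d \<eta> (Y :: nat \<Rightarrow> real ^ 'p \<Rightarrow> real ^ 'p) S. unit_gauge U d \<longrightarrow> 0 \<le> \<eta> \<longrightarrow>
     fields_bounded d U M s {..n} Y \<longrightarrow> fields_bounded d U M s {..n} S \<longrightarrow> fields_close d U \<eta> s {..n} Y S \<longrightarrow>
     (\<forall>j. Ck_flat d U (s - weight I) (C * \<eta>) (s - weight I)
       (\<lambda>x. iter_bracket Y I x $ j - iter_bracket S I x $ j))"
proof (rule finite_uniform_bound[OF finite_multiindices])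
  fix I assume "I \<in> multiindices n r"
  then have I: "I \<noteq> []" "weight I \<le> s" "set I \<subseteq> {..n}" using assms(2) by (auto simp: multiindices_def)
  show "\<exists>C\<ge>0. \<forall>U d \<eta> (Y :: nat \<Rightarrow> real ^ 'p \<Rightarrow> real ^ 'p) S. unit_gauge U d \<longrightarrow> 0 \<le> \<eta> \<longrightarrow>
     fields_bounded d U M s {..n} Y \<longrightarrow> fields_bounded d U M s {..n} S \<longrightarrow> fields_close d U \<eta> s {..n} Y S \<longrightarrow>
     (\<forall>j. Ck_flat d U (s - weight I) (C * \<eta>) (s - weight I)
       (\<lambda>x. iter_bracket Y I x $ j - iter_bracket S I x $ j))"
    by (rule Ck_flat_iter_bracket_diff[OF I assms(1)])
next
  fix I and C C' :: real
  assume *: "\<forall>U d \<eta> (Y :: nat \<Rightarrow> real ^ 'p \<Rightarrow> real ^ 'p) S. unit_gauge U d \<longrightarrow> 0 \<le> \<eta> \<longrightarrow>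
     fields_bounded d U M s {..n} Y \<longrightarrow> fields_bounded d U M s {..n} S \<longrightarrow> fields_close d U \<eta> s {..n} Y S \<longrightarrow>
     (\<forall>j. Ck_flat d U (s - weight I) (C * \<eta>) (s - weight I)
       (\<lambda>x. iter_bracket Y I x $ j - iter_bracket S I x $ j))"
    and C: "0 \<le> C" "C \<le> C'"
  show "\<forall>U d \<eta> (Y :: nat \<Rightarrow> real ^ 'p \<Rightarrow> real ^ 'p) S. unit_gauge U d \<longrightarrow> 0 \<le> \<eta> \<longrightarrow>
     fields_bounded d U M s {..n} Y \<longrightarrow> fields_bounded d U M s {..n} S \<longrightarrow> fields_close d U \<eta> s {..n} Y S \<longrightarrow>
     (\<forall>j. Ck_flat d U (s - weight I) (C' * \<eta>) (s - weight I)
       (\<lambda>x. iter_bracket Y I x $ j - iter_bracket S I x $ j))"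
  proof (intro allI impI)
    fix U d \<eta> and Y S :: "nat \<Rightarrow> real ^ 'p \<Rightarrow> real ^ 'p" and j
    assume h: "unit_gauge U d" "0 \<le> \<eta>"
      "fields_bounded d U M s {..n} Y" "fields_bounded d U M s {..n} S" "fields_close d U \<eta> s {..n} Y S"
    then have "Ck_flat d U (s - weight I) (C * \<eta>) (s - weight I)
      (\<lambda>x. iter_bracket Y I x $ j - iter_bracket S I x $ j)"
      using * by blast
    moreover have "C * \<eta> \<le> C' * \<eta>" "0 \<le> C * \<eta>" using C h(2) by (auto intro: mult_right_mono)
    ultimately show "Ck_flat d U (s - weight I) (C' * \<eta>) (s - weight I)
      (\<lambda>x. iter_bracket Y I x $ j - iter_bracket S I x $ j)"
      by (rule Ck_flat_mono[OF _ _ _ order_refl order_refl unit_gaugeD(2)[OF h(1)]])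
  qed
qed

lemma norm_le_components:
  fixes v :: "real ^ 'p"
  assumes "\<And>j. \<bar>v $ j\<bar> \<le> b"
  shows "norm v \<le> real CARD('p) * b"
  using order_trans[OF norm_le_l1_cart sum_bounded_above[of UNIV "\<lambda>j. \<bar>v $ j\<bar>" b]] assms by simp

text \<open>Only the degree \<open>r - wt i\<close> matters, and it takes values up to
  \<open>r\<close>; so a maximum over finitely many degrees serves all \<open>i\<close>. Asking for
  \<open>K \<le> M\<close> lets one constant bound both systems.\<close>

lemma taylor_fields_bound:
  assumes "1 \<le> D" "0 \<le> K"
  shows "\<exists>M\<ge>K. \<forall>i U d (x0 :: real ^ 'p) f. unit_gauge U d \<longrightarrow> (\<forall>x\<in>U. dist x x0 \<le> D) \<longrightarrow>
    (\<forall>\<alpha>. length \<alpha> \<le> r - wt i \<longrightarrow> \<bar>pderivs \<alpha> f x0\<bar> \<le> K) \<longrightarrow> Ck_flat d U 0 M k (taylor_poly (r - wt i) f x0)"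
proof -
  let ?P = "\<lambda>m C. \<forall>U d (x0 :: real ^ 'p) f. unit_gauge U d \<longrightarrow> (\<forall>x\<in>U. dist x x0 \<le> D) \<longrightarrow>
    (\<forall>\<alpha>. length \<alpha> \<le> m \<longrightarrow> \<bar>pderivs \<alpha> f x0\<bar> \<le> K) \<longrightarrow> Ck_flat d U 0 C k (taylor_poly m f x0)"
  have mono: "?P m C'" if P: "?P m C" and C: "0 \<le> C" "C \<le> C'" for m C C'
  proof (intro allI impI)
    fix U d and x0 :: "real ^ 'p" and f
    assume h: "unit_gauge U d" "\<forall>x\<in>U. dist x x0 \<le> D"
      "\<forall>\<alpha>. length \<alpha> \<le> m \<longrightarrow> \<bar>pderivs \<alpha> f x0\<bar> \<le> K"
    then have "Ck_flat d U 0 C k (taylor_poly m f x0)" using P by blast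
    then show "Ck_flat d U 0 C' k (taylor_poly m f x0)"
      by (rule Ck_flat_mono[OF _ C(2,1) order_refl order_refl unit_gaugeD(2)[OF h(1)]])
  qed
  have "\<exists>C\<ge>0. \<forall>m\<in>{..r}. ?P m C"
  proof (rule finite_uniform_bound)
    fix m and C C' :: real assume "?P m C" "0 \<le> C" "C \<le> C'"
    then show "?P m C'" by (rule mono)
  next
    fix m
    show "\<exists>C\<ge>0. ?P m C" by (rule Ck_flat_taylor_poly[OF assms])
  qed simp
  then obtain C where C: "0 \<le> C" "\<And>m. m \<le> r \<Longrightarrow> ?P m C" by auto
  have "?P m (max K C)" if "m \<le> r" for m
    by (rule mono[OF C(2)[OF that] C(1)]) simp
  moreover have "K \<le> max K C" by simp
  ultimately show ?thesis using diff_le_self by blast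
qed

text \<open>\<open>B\<close> stands in front of \<epsilon> because the admissible tolerance will be
  computed from \<open>B\<close>; \<open>R\<close> stands in front of the fields and the centre,
  which is the uniformity claimed by the theorem.\<close>

lemma uniform_estimates:
  fixes \<Omega> \<Omega>' :: "(real ^ 'p) set" and K c0 :: real
  assumes \<Omega>: "open \<Omega>" "bounded \<Omega>" and \<Omega>': "compact (closure \<Omega>')" "closure \<Omega>' \<subseteq> \<Omega>"
    and "r \<ge> 2" and \<omega>: "(\<omega> \<longlongrightarrow> 0) (at_right 0)"
  shows "\<exists>B\<ge>0. \<forall>\<epsilon>>0. \<exists>R>0. \<forall>(X :: nat \<Rightarrow> real ^ 'p \<Rightarrow> real ^ 'p) x0.
    assumption_A1 \<Omega> n r X \<and> controlled_by \<Omega> \<Omega>' n r K \<omega> c0 X \<and> x0 \<in> \<Omega>' \<longrightarrow>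
    (\<forall>I\<in>multiindices n r.
      continuous_on \<Omega> (iter_bracket X I) \<and> continuous_on \<Omega> (iter_bracket (approx_field r X x0) I) \<and>
      (\<forall>x\<in>\<Omega>. norm (iter_bracket X I x) \<le> B \<and> norm (iter_bracket (approx_field r X x0) I x) \<le> B) \<and>
      (\<forall>x\<in>ball x0 R. norm (iter_bracket X I x - iter_bracket (approx_field r X x0) I x) \<le>
        \<epsilon> * dist x x0 ^ (r - weight I) \<and>
        norm (iter_bracket (approx_field r X x0) I x - iter_bracket (approx_field r X x0) I x0) \<le> \<epsilon>))"
proof -
  let ?p = "real CARD('p)" and ?MI = "multiindices n r"
  have p: "1 \<le> ?p" using zero_less_card_finite[where 'a='p] by linarith
  obtain D where D: "1 \<le> D" "\<And>x y. x \<in> \<Omega> \<Longrightarrow> y \<in> \<Omega> \<Longrightarrow> dist x y \<le> D"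
    using diameter_bounded_bound[OF \<Omega>(2)] by (metis max.cobounded1 max.coboundedI2)
  obtain R0 where R0: "R0 > 0" "\<And>x. x \<in> \<Omega>' \<Longrightarrow> ball x R0 \<subseteq> \<Omega>"
  proof -
    from compact_subset_open_imp_ball_epsilon_subset[OF \<Omega>'(1) \<Omega>(1) \<Omega>'(2)]
    obtain e where "e > 0" "(\<Union>x\<in>closure \<Omega>'. ball x e) \<subseteq> \<Omega>" by blast
    then show ?thesis using that[of e] closure_subset[of \<Omega>'] by blast
  qed
  \<comment> \<open>The absolute value makes the bound nonnegative, whatever the sign of
    \<open>K\<close>.\<close>
  obtain M where M: "\<bar>K\<bar> \<le> M" "\<And>i U d (x0 :: real ^ 'p) f. unit_gauge U d \<Longrightarrow> \<forall>x\<in>U. dist x x0 \<le> D \<Longrightarrow>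
      \<forall>\<alpha>. length \<alpha> \<le> r - wt i \<longrightarrow> \<bar>pderivs \<alpha> f x0\<bar> \<le> \<bar>K\<bar> \<Longrightarrow> Ck_flat d U 0 M r (taylor_poly (r - wt i) f x0)"
    using taylor_fields_bound[OF D(1) abs_ge_zero, of K r r, where 'p = 'p] by auto
  have M0: "0 \<le> M" using M(1) by simp
  obtain B1 where B1': "0 \<le> B1 \<and> (\<forall>I\<in>?MI. \<forall>U d (Y :: nat \<Rightarrow> real ^ 'p \<Rightarrow> real ^ 'p). unit_gauge U d \<longrightarrow>
     fields_bounded d U M r {..n} Y \<longrightarrow> (\<forall>j. Ck_flat d U 0 B1 (r - weight I)
       (\<lambda>x. iter_bracket Y I x $ j)))"
    using brackets_bound[OF M0 order_refl, where 'p = 'p and r = r and n = n] ..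
  note B1 = conjunct1[OF B1'] conjunct2[OF B1', rule_format]
  \<comment> \<open>For the polynomial system only: one order more than in \<open>B1\<close>, to
    obtain a Lipschitz bound at weight \<open>r\<close> as well.\<close>
  obtain B2 where B2': "0 \<le> B2 \<and> (\<forall>I\<in>?MI. \<forall>U d (Y :: nat \<Rightarrow> real ^ 'p \<Rightarrow> real ^ 'p). unit_gauge U d \<longrightarrow>
     fields_bounded d U M (Suc r) {..n} Y \<longrightarrow> (\<forall>j. Ck_flat d U 0 B2 (Suc r - weight I)
       (\<lambda>x. iter_bracket Y I x $ j)))"
    using brackets_bound[OF M0 le_SucI[OF order_refl], where 'p = 'p and r = r and n = n] ..
  note B2 = conjunct1[OF B2'] conjunct2[OF B2', rule_format]
  obtain B3 where B3': "0 \<le> B3 \<and> (\<forall>I\<in>?MI. \<forall>U d \<eta> (Y :: nat \<Rightarrow> real ^ 'p \<Rightarrow> real ^ 'p) S. unit_gauge U d \<longrightarrow>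
    0 \<le> \<eta> \<longrightarrow>
     fields_bounded d U M r {..n} Y \<longrightarrow> fields_bounded d U M r {..n} S \<longrightarrow> fields_close d U \<eta> r {..n} Y S \<longrightarrow>
     (\<forall>j. Ck_flat d U (r - weight I) (B3 * \<eta>) (r - weight I)
       (\<lambda>x. iter_bracket Y I x $ j - iter_bracket S I x $ j)))"
    using brackets_diff_bound[OF M0 order_refl, where 'p = 'p and r = r and n = n] ..
  note B3 = conjunct1[OF B3'] conjunct2[OF B3', rule_format]
  show ?thesis
  proof (rule exI[of _ "?p * B1"], intro conjI allI impI)
    show "0 \<le> ?p * B1" using B1(1) by simp
    fix \<epsilon> :: real assume "0 < \<epsilon>"
    \<comment> \<open>The factors of the denominator stem from passing from components to the norm,
      from the commutators, and from the Taylor remainder; \<open>B3 + 1\<close> is used since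
      \<open>B3\<close> may be 0.\<close>
    define \<eta> where "\<eta> = \<epsilon> / (?p * (B3 + 1) * ?p ^ r)"
    have \<eta>: "0 < \<eta>" using \<open>0 < \<epsilon>\<close> p B3(1) by (simp add: \<eta>_def)
    have \<eta>\<epsilon>: "?p * (B3 * (?p ^ r * \<eta>)) \<le> \<epsilon>"
    proof -
      have "?p * (B3 * (?p ^ r * \<eta>)) \<le> ?p * ((B3 + 1) * (?p ^ r * \<eta>))"
        using p \<eta> by (intro mult_left_mono mult_right_mono) auto
      also have "\<dots> = (?p * (B3 + 1) * ?p ^ r) * \<eta>" by (simp only: mult_ac)
      also have "\<dots> = \<epsilon>"
      proof -
        have "?p * (B3 + 1) * ?p ^ r \<noteq> 0" using p B3(1) by simp
        then show ?thesis by (simp add: \<eta>_def)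
      qed
      finally show ?thesis .
    qed
    obtain t0 where t0: "t0 > 0" "\<And>t. 0 < t \<Longrightarrow> t < t0 \<Longrightarrow> \<omega> t \<le> \<eta>"
    proof -
      have "eventually (\<lambda>t. \<omega> t < \<eta>) (at_right 0)" using \<omega> \<eta> by (rule order_tendstoD(2))
      then obtain b where "b > 0" "\<forall>t>0. t < b \<longrightarrow> \<omega> t < \<eta>" unfolding eventually_at_right_field by auto
      then show ?thesis using that[of b] by (simp add: less_imp_le)
    qed
    \<comment> \<open>In turn: the ball stays in \<Omega>, the truncated distance is the distance,
      the moduli of continuity are at most \<eta>, and the commutators of the approximating fields
      vary by at most \<epsilon>.\<close>
    define R where "R = min (min R0 1) (min t0 (\<epsilon> / (?p * ?p * (B2 + 1))))"
    have R: "0 < R" "R \<le> R0" "R \<le> 1" "R \<le> t0"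
      using R0(1) t0(1) \<open>0 < \<epsilon>\<close> p B2(1) by (auto simp: R_def)
    have R\<epsilon>: "?p * (?p * B2 * R) \<le> \<epsilon>"
    proof -
      have "?p * (?p * B2 * R) \<le> ?p * (?p * (B2 + 1) * (\<epsilon> / (?p * ?p * (B2 + 1))))"
        using p B2(1) R(1) by (intro mult_left_mono mult_mono) (auto simp: R_def)
      also have "\<dots> = \<epsilon>"
      proof -
        have "?p * ?p * (B2 + 1) \<noteq> 0" using p B2(1) by simp
        then show ?thesis
          by (simp only: mult.assoc[symmetric] times_divide_eq_right)
            (erule nonzero_mult_div_cancel_left)
      qed
      finally show ?thesis .
    qed
    show "\<exists>R>0. \<forall>(X :: nat \<Rightarrow> real ^ 'p \<Rightarrow> real ^ 'p) x0.
      assumption_A1 \<Omega> n r X \<and> controlled_by \<Omega> \<Omega>' n r K \<omega> c0 X \<and> x0 \<in> \<Omega>' \<longrightarrow>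
      (\<forall>I\<in>multiindices n r.
        continuous_on \<Omega> (iter_bracket X I) \<and> continuous_on \<Omega> (iter_bracket (approx_field r X x0) I) \<and>
        (\<forall>x\<in>\<Omega>. norm (iter_bracket X I x) \<le> ?p * B1 \<and> norm (iter_bracket (approx_field r X x0) I x) \<le>
          ?p * B1) \<and>
        (\<forall>x\<in>ball x0 R. norm (iter_bracket X I x - iter_bracket (approx_field r X x0) I x) \<le>
          \<epsilon> * dist x x0 ^ (r - weight I) \<and>
          norm (iter_bracket (approx_field r X x0) I x - iter_bracket (approx_field r X x0) I x0) \<le> \<epsilon>))"
    proof (rule exI[of _ R], intro conjI[OF R(1)] allI impI ballI, elim conjE)
      fix X :: "nat \<Rightarrow> real ^ 'p \<Rightarrow> real ^ 'p" and x0 I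
      assume A1: "assumption_A1 \<Omega> n r X" and ctrl: "controlled_by \<Omega> \<Omega>' n r K \<omega> c0 X"
        and x0: "x0 \<in> \<Omega>'" and I: "I \<in> ?MI"
      let ?S = "approx_field r X x0" and ?U = "ball x0 R" and ?d = "\<lambda>x. min 1 (dist x x0)"
      have gauge\<Omega>: "unit_gauge \<Omega> ?d" and gaugeU: "unit_gauge ?U ?d" using \<Omega>(1)
        by (auto simp: unit_gauge_def)
      have U: "?U \<subseteq> \<Omega>" using R0(2)[OF x0] R(2) by force
      have x0U: "x0 \<in> ?U" using R(1) by simp
      have x0\<Omega>: "x0 \<in> \<Omega>" using x0U U by blast
      have wI: "weight I \<le> r" using I by (simp add: multiindices_def)
      have cl: "Ck_closure (r - wt i) \<Omega> (\<lambda>x. X i x $ j)" if "i \<le> n" for i j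
        using A1 that by (cases "i = 0") (auto simp: assumption_A1_def wt_def)
      have nrm: "Ck_norm (r - wt i) \<Omega> (\<lambda>x. X i x $ j) \<le> \<bar>K\<bar>" if "i \<le> n" for i j
        using ctrl that abs_ge_self[of K] unfolding controlled_by_def by (metis order_trans)
      have X: "Ck_flat ?d \<Omega> 0 M (r - wt i) (\<lambda>x. X i x $ j)" if "i \<le> n" for i j
        using Ck_closure_Ck_flat[OF \<Omega>(2) cl[OF that] order_trans[OF nrm[OF that] M(1)]] .
      have S_eq: "(\<lambda>x. ?S i x $ j) = taylor_poly (r - wt i) (\<lambda>x. X i x $ j) x0" for i j
        by (simp add: approx_field_def)
      have Sr: "Ck_flat ?d \<Omega> 0 M r (\<lambda>x. ?S i x $ j)" if "i \<le> n" for i j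
        unfolding S_eq
      proof (rule M(2)[OF gauge\<Omega>])
        show "\<forall>x\<in>\<Omega>. dist x x0 \<le> D" using D(2) x0\<Omega> by blast
        show "\<forall>\<alpha>. length \<alpha> \<le> r - wt i \<longrightarrow> \<bar>pderivs \<alpha> (\<lambda>x. X i x $ j) x0\<bar> \<le> \<bar>K\<bar>"
          using Ck_norm_bound[OF \<Omega>(2) cl[OF that] _ x0\<Omega>] nrm[OF that] by (meson order_trans)
      qed
      have S: "Ck_flat ?d \<Omega> 0 M (r - wt i) (\<lambda>x. ?S i x $ j)"
        "Ck_flat ?d \<Omega> 0 M (Suc r - wt i) (\<lambda>x. ?S i x $ j)" if "i \<le> n" for i j
        using wt_pos[of i] M0 by (auto intro!: Ck_flat_mono[OF Sr[OF that]])
      have XS: "Ck_flat ?d ?U (r - wt i) (?p ^ r * \<eta>) (r - wt i) (\<lambda>x. X i x $ j - ?S i x $ j)"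
        if i: "i \<le> n" for i j
      proof -
        let ?f = "\<lambda>x. X i x $ j" and ?k = "r - wt i"
        have "Ck_flat ?d ?U ?k (?p ^ ?k * \<eta>) ?k (\<lambda>x. ?f x - taylor_poly ?k ?f x0 x)"
        proof (rule Ck_flat_taylor_remainder)
          show "Ck_flat ?d ?U 0 M ?k ?f" using X[OF i] U by (rule Ck_flat_subset)
          fix \<alpha> :: "'p list" and x assume \<alpha>: "length \<alpha> = ?k" and x: "x \<in> ?U"
          have "length \<alpha> \<le> ?k" using \<alpha> by simp
          then obtain g where g: "continuous_on (closure \<Omega>) g" "\<forall>x\<in>\<Omega>. g x = pderivs \<alpha> ?f x"
            using cl[OF i, of j] unfolding Ck_closure_def by blast
          show "\<bar>pderivs \<alpha> ?f x - pderivs \<alpha> ?f x0\<bar> \<le> \<eta>"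
          \<comment> \<open>The moduli of continuity are controlled for positive arguments
            only.\<close>
          proof (cases "x = x0")
            case True
            then show ?thesis using \<eta> by simp
          next
            case False
            then have t: "0 < dist x x0" "dist x x0 < t0" using x R(4) by (auto simp: dist_commute)
            have "\<bar>pderivs \<alpha> ?f x - pderivs \<alpha> ?f x0\<bar> \<le> continuity_modulus \<Omega> (pderivs \<alpha> ?f) (dist x x0)"
              using x U x0\<Omega> g(2) by (intro continuity_modulus_bound[OF \<Omega> g(1)]) auto
            also have "\<dots> \<le> \<omega> (dist x x0)"
              using ctrl i \<alpha> t(1) unfolding controlled_by_def by blast
            also have "\<dots> \<le> \<eta>" by (rule t0(2)[OF t])
            finally show ?thesis .
          qed
        qed (use R \<eta> in auto)
        moreover have "?p ^ ?k * \<eta> \<le> ?p ^ r * \<eta>"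
          using p \<eta> by (intro mult_right_mono power_increasing) auto
        moreover have "0 \<le> ?p ^ ?k * \<eta>" using \<eta> by simp
        ultimately show ?thesis
          unfolding S_eq[THEN fun_cong]
          by (rule Ck_flat_mono[OF _ _ _ order_refl order_refl unit_gaugeD(2)[OF gaugeU]])
      qed
      have fb: "fields_bounded ?d \<Omega> M r {..n} X" "fields_bounded ?d \<Omega> M r {..n} ?S"
        "fields_bounded ?d \<Omega> M (Suc r) {..n} ?S"
        using X S by (auto simp: fields_bounded_def)
      have fbU: "fields_bounded ?d ?U M r {..n} X" "fields_bounded ?d ?U M r {..n} ?S"
        using X S(1) by (auto simp: fields_bounded_def intro: Ck_flat_subset[OF _ U])
      have fc: "fields_close ?d ?U (?p ^ r * \<eta>) r {..n} X ?S" using XS by (simp add: fields_close_def)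
      note bX = B1(2)[OF I gauge\<Omega> fb(1)]
      note bS = B1(2)[OF I gauge\<Omega> fb(2)]
      have bS2: "Ck_flat ?d \<Omega> 0 B2 (Suc (r - weight I)) (\<lambda>x. iter_bracket ?S I x $ j)" for j
        using B2(2)[OF I gauge\<Omega> fb(3), of j] wI by (simp add: Suc_diff_le del: Ck_flat.simps)
      have "0 \<le> ?p ^ r * \<eta>" using \<eta> by simp
      note bXS = B3(2)[OF I gaugeU this fbU fc]
      have vec: "continuous_on V h" if "\<And>j. continuous_on V (\<lambda>x. h x $ j)" for V
        and h :: "real ^ 'p \<Rightarrow> real ^ 'p"
        using continuous_on_vec_lambda[of V "\<lambda>j x. h x $ j"] that by simp
      have cX: "continuous_on \<Omega> (iter_bracket X I)" and cS: "continuous_on \<Omega> (iter_bracket ?S I)"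
        using bX bS by (auto intro!: vec Ck_flat_continuous)
      have nX: "norm (iter_bracket X I x) \<le> ?p * B1" and nS: "norm (iter_bracket ?S I x) \<le> ?p * B1"
        if "x \<in> \<Omega>" for x
        using Ck_flat_bound[OF bX that] Ck_flat_bound[OF bS that] by (auto intro!: norm_le_components)
      have nXS: "norm (iter_bracket X I x - iter_bracket ?S I x) \<le> \<epsilon> * dist x x0 ^ (r - weight I)"
        if x: "x \<in> ?U" for x
      proof -
        have dx: "?d x = dist x x0" using x R(3) by (simp add: dist_commute)
        have "norm (iter_bracket X I x - iter_bracket ?S I x) \<le>
          ?p * (B3 * (?p ^ r * \<eta>) * dist x x0 ^ (r - weight I))"
          using Ck_flat_bound[OF bXS x] unfolding dx by (intro norm_le_components) simp
        also have "\<dots> = ?p * (B3 * (?p ^ r * \<eta>)) * dist x x0 ^ (r - weight I)" by simp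
        also have "\<dots> \<le> \<epsilon> * dist x x0 ^ (r - weight I)" using \<eta>\<epsilon> by (intro mult_right_mono) auto
        finally show ?thesis .
      qed
      have nSS: "norm (iter_bracket ?S I x - iter_bracket ?S I x0) \<le> \<epsilon>" if x: "x \<in> ?U" for x
      proof -
        have "\<bar>iter_bracket ?S I x $ j - iter_bracket ?S I x0 $ j\<bar> \<le> ?p * B2 * dist x x0" for j
        proof (rule pderiv1_mean_value[OF convex_ball _ _ x x0U])
          fix y assume "y \<in> ?U"
          then have y: "y \<in> \<Omega>" using U by blast
          then show "(\<lambda>x. iter_bracket ?S I x $ j) differentiable (at y)" using bS2[of j] by simp
          show "\<bar>pderiv1 i (\<lambda>x. iter_bracket ?S I x $ j) y\<bar> \<le> B2" for i
            using Ck_flat_bound[OF Ck_flat_pderiv1[OF bS2] y, of i j] by simp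
        qed
        also have "?p * B2 * dist x x0 \<le> ?p * B2 * R"
          using x B2(1) by (intro mult_left_mono) (auto simp: dist_commute)
        finally have "norm (iter_bracket ?S I x - iter_bracket ?S I x0) \<le> ?p * (?p * B2 * R)"
          by (intro norm_le_components) simp
        then show ?thesis using R\<epsilon> by linarith
      qed
      show "continuous_on \<Omega> (iter_bracket X I) \<and> continuous_on \<Omega> (iter_bracket ?S I) \<and>
        (\<forall>x\<in>\<Omega>. norm (iter_bracket X I x) \<le> ?p * B1 \<and> norm (iter_bracket ?S I x) \<le> ?p * B1) \<and>
        (\<forall>x\<in>?U. norm (iter_bracket X I x - iter_bracket ?S I x) \<le> \<epsilon> * dist x x0 ^ (r - weight I) \<and>
          norm (iter_bracket ?S I x - iter_bracket ?S I x0) \<le> \<epsilon>)"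
        using cX cS nX nS nXS nSS by blast
    qed
  qed
qed

section \<open>Inclusion of the balls\<close>

lemma cc_ball_subsetI:
  assumes "\<And>\<delta> \<phi>. 0 < \<delta> \<Longrightarrow> \<delta> < \<rho> \<Longrightarrow> \<phi> \<in> curve_class \<Omega> n r Y \<delta> \<Longrightarrow> \<phi> 0 = x \<Longrightarrow> \<phi> \<in> curve_class \<Omega> n r Z (D * \<delta>)"
    and "0 < D"
  shows "cc_ball \<Omega> n r Y x \<rho> \<subseteq> cc_ball \<Omega> n r Z x (D * \<rho>)"
proof
  fix y assume "y \<in> cc_ball \<Omega> n r Y x \<rho>"
  then obtain \<delta> \<phi> where *: "y \<in> \<Omega>" "0 < \<delta>" "\<delta> < \<rho>" "\<phi> \<in> curve_class \<Omega> n r Y \<delta>" "\<phi> 0 = x" "\<phi> 1 = y"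
    unfolding cc_ball_def cc_dist_def Inf_less_iff by auto
  then have "\<phi> \<in> curve_class \<Omega> n r Z (D * \<delta>)" using assms(1) by blast
  then have "cc_dist \<Omega> n r Z x y \<le> ereal (D * \<delta>)"
    unfolding cc_dist_def using * assms(2) by (intro Inf_lower) auto
  also have "\<dots> < ereal (D * \<rho>)" using *(3) assms(2) by simp
  finally show "y \<in> cc_ball \<Omega> n r Z x (D * \<rho>)" using *(1) by (simp add: cc_ball_def)
qed

theorem theorem3p4:
  fixes \<Omega> \<Omega>' :: "(real ^ 'p) set"
    and n r :: nat
    and K c0 :: real
    and \<omega> :: "real \<Rightarrow> real"
  assumes "domain_set \<Omega>" "bounded \<Omega>"
    and "compactly_inside \<Omega>' \<Omega>"
    and "r \<ge> 2"
    and "c0 > 0"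
    and "(\<omega> \<longlongrightarrow> 0) (at_right 0)"
  shows "\<exists>c1 c2 r0. c1 > 0 \<and> c2 > 0 \<and> r0 > 0 \<and>
    (\<forall>X :: nat \<Rightarrow> real ^ 'p \<Rightarrow> real ^ 'p.
       assumption_A1 \<Omega> n r X \<and> assumption_A2 \<Omega> n r X \<and> controlled_by \<Omega> \<Omega>' n r K \<omega> c0 X \<longrightarrow>
       (\<forall>x0\<in>\<Omega>'. \<forall>\<rho>. 0 < \<rho> \<and> \<rho> < r0 \<longrightarrow>
          cc_ball \<Omega> n r (approx_field r X x0) x0 (c1 * \<rho>) \<subseteq> cc_ball \<Omega> n r X x0 \<rho> \<and>
          cc_ball \<Omega> n r X x0 \<rho> \<subseteq> cc_ball \<Omega> n r (approx_field r X x0) x0 (c2 * \<rho>)))"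
proof -
  let ?MI = "multiindices n r"
  have \<Omega>: "open \<Omega>" "compact (closure \<Omega>')" "closure \<Omega>' \<subseteq> \<Omega>"
    using assms(1,3) by (auto simp: domain_set_def compactly_inside_def)
  obtain B where B: "B \<ge> 0" "\<forall>\<epsilon>>0. \<exists>R>0. \<forall>(X :: nat \<Rightarrow> real ^ 'p \<Rightarrow> real ^ 'p) x0.
    assumption_A1 \<Omega> n r X \<and> controlled_by \<Omega> \<Omega>' n r K \<omega> c0 X \<and> x0 \<in> \<Omega>' \<longrightarrow>
    (\<forall>I\<in>?MI.
      continuous_on \<Omega> (iter_bracket X I) \<and> continuous_on \<Omega> (iter_bracket (approx_field r X x0) I) \<and>
      (\<forall>x\<in>\<Omega>. norm (iter_bracket X I x) \<le> B \<and> norm (iter_bracket (approx_field r X x0) I x) \<le> B) \<and>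
      (\<forall>x\<in>ball x0 R. norm (iter_bracket X I x - iter_bracket (approx_field r X x0) I x) \<le>
        \<epsilon> * dist x x0 ^ (r - weight I) \<and>
        norm (iter_bracket (approx_field r X x0) I x - iter_bracket (approx_field r X x0) I x0) \<le> \<epsilon>))"
    using uniform_estimates[OF \<Omega>(1) assms(2) \<Omega>(2,3) assms(4,6), of n K c0] by (elim exE conjE)
  obtain \<epsilon>' L where \<epsilon>': "\<epsilon>' > 0" and L: "L \<ge> 0" "\<And>v v' :: 'p \<Rightarrow> real ^ 'p.
      (\<And>i. norm (v i) \<le> B) \<Longrightarrow> c0 \<le> \<bar>det (\<chi> i. v i)\<bar> \<Longrightarrow> (\<And>i. norm (v' i - v i) \<le> \<epsilon>') \<Longrightarrow>
      det (\<chi> i. v' i) \<noteq> 0 \<and> (\<forall>w k. \<bar>cramer_coeff v' w k\<bar> \<le> L * norm w)"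
    using cramer_coeff_perturbation[OF assms(5) B(1), where 'n = 'p] by metis
  \<comment> \<open>\<open>near\<close> will add up to three errors of size \<epsilon>, and
    \<epsilon> at most 1 allows the contact estimate to be used with constant 1.\<close>
  define \<epsilon> where "\<epsilon> = min 1 (\<epsilon>' / 3)"
  have \<epsilon>: "0 < \<epsilon>" "\<epsilon> \<le> 1" "3 * \<epsilon> \<le> \<epsilon>'" using \<epsilon>' by (auto simp: \<epsilon>_def)
  obtain R where R: "R > 0" and est: "\<And>(X :: nat \<Rightarrow> real ^ 'p \<Rightarrow> real ^ 'p) x0 I.
      assumption_A1 \<Omega> n r X \<Longrightarrow> controlled_by \<Omega> \<Omega>' n r K \<omega> c0 X \<Longrightarrow> x0 \<in> \<Omega>' \<Longrightarrow> I \<in> ?MI \<Longrightarrow>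
      continuous_on \<Omega> (iter_bracket X I) \<and> continuous_on \<Omega> (iter_bracket (approx_field r X x0) I) \<and>
      (\<forall>x\<in>\<Omega>. norm (iter_bracket X I x) \<le> B \<and> norm (iter_bracket (approx_field r X x0) I x) \<le> B) \<and>
      (\<forall>x\<in>ball x0 R. norm (iter_bracket X I x - iter_bracket (approx_field r X x0) I x) \<le>
        \<epsilon> * dist x x0 ^ (r - weight I) \<and>
        norm (iter_bracket (approx_field r X x0) I x - iter_bracket (approx_field r X x0) I x0) \<le> \<epsilon>)"
    using B(2)[rule_format, OF \<epsilon>(1)] by (elim exE conjE) (simp only: atomize_imp atomize_all, blast)
  \<comment> \<open>The speed bound of \<open>curve_class_growth\<close>, raised to at least 1 so
    that \<open>G ^ (r - weight I)\<close> is at most \<open>E\<close> for every commutator.\<close>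
  define G where "G = max 1 (real (card ?MI) * B)"
  define E where "E = G ^ r"
  define D where "D = 1 + real (card ?MI) * real CARD('p) * L * E"
  \<comment> \<open>Curves with \<delta> below \<open>r0\<close> stay closer to \<open>x0\<close>
    than \<open>R\<close>, where the contact estimates hold, and closer than 1, where powers of the
    distance are at most 1.\<close>
  define r0 where "r0 = min 1 (min 1 R / G)"
  have G: "1 \<le> G" "real (card ?MI) * B \<le> G" by (auto simp: G_def)
  have E: "0 \<le> E" using G(1) by (simp add: E_def)
  have D: "1 \<le> D" using L(1) E by (simp add: D_def)
  have r0: "0 < r0" "r0 \<le> 1" "G * r0 \<le> min 1 R"
  proof -
    have "r0 \<le> min 1 R / G" by (simp add: r0_def)
    then show "G * r0 \<le> min 1 R" using G(1) by (simp add: le_divide_eq mult.commute)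
  qed (use R G(1) in \<open>auto simp: r0_def\<close>)
  \<comment> \<open>Both directions at once: the basis is selected from X at \<open>x0\<close> in
    either case, and whichever system is the target is a perturbation of it.\<close>
  have transfer: "\<phi> \<in> curve_class \<Omega> n r Z (D * \<delta>)"
    if A1: "assumption_A1 \<Omega> n r X" and ctrl: "controlled_by \<Omega> \<Omega>' n r K \<omega> c0 X" and x0: "x0 \<in> \<Omega>'"
      and \<delta>: "0 < \<delta>" "\<delta> < r0" and \<phi>: "\<phi> \<in> curve_class \<Omega> n r Y \<delta>" "\<phi> 0 = x0"
      and YZ: "Y = X \<and> Z = approx_field r X x0 \<or> Y = approx_field r X x0 \<and> Z = X"
    for X Y Z :: "nat \<Rightarrow> real ^ 'p \<Rightarrow> real ^ 'p" and x0 \<delta> \<phi>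
  proof -
    let ?S = "approx_field r X x0"
    note e = est[OF A1 ctrl x0]
    have \<delta>1: "\<delta> \<le> 1" using \<delta> r0 by linarith
    have GR: "G * \<delta> < min 1 R" using mult_strict_left_mono[OF \<delta>(2), of G] r0(3) G(1) by linarith
    have im: "\<phi> ` {0..1} \<subseteq> \<Omega>" using \<phi>(1) by (simp add: curve_class_def)
    have x0\<Omega>: "x0 \<in> \<Omega>" using im \<phi>(2) by force
    obtain \<I> :: "'p \<Rightarrow> nat list" where \<I>: "\<And>k. \<I> k \<in> ?MI" "c0 \<le> \<bar>det (\<chi> k. iter_bracket X (\<I> k) x0)\<bar>"
      using max_det_witness[OF assms(4) _ x0, of c0 n X] ctrl unfolding controlled_by_def by blast
    define V where "V = \<Omega> \<inter> cball x0 (G * \<delta>)"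
    have VR: "x \<in> ball x0 R" if "x \<in> V" for x using that GR by (auto simp: V_def)
    have "dist (\<phi> t) (\<phi> 0) \<le> real (card ?MI) * B * \<delta>" if "t \<in> {0..1}" for t
      using YZ e by (intro curve_class_growth[OF \<phi>(1) \<delta>(1) \<delta>1 B(1) _ that]) auto
    moreover have "real (card ?MI) * B * \<delta> \<le> G * \<delta>" using G(2) \<delta>(1) by (intro mult_right_mono) auto
    ultimately have V: "\<phi> ` {0..1} \<subseteq> V"
      using im \<phi>(2) unfolding V_def by (fastforce simp: dist_commute)
    have diff: "norm (iter_bracket X I x - iter_bracket ?S I x) \<le> E * \<delta> ^ (r - weight I)"
      if I: "I \<in> ?MI" and x: "x \<in> V" for I x
    proof -
      have "norm (iter_bracket X I x - iter_bracket ?S I x) \<le> \<epsilon> * dist x x0 ^ (r - weight I)"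
        using e[OF I] VR[OF x] by blast
      also have "\<dots> \<le> 1 * (G * \<delta>) ^ (r - weight I)"
        using \<epsilon> x by (intro mult_mono power_mono) (auto simp: V_def dist_commute)
      also have "\<dots> = G ^ (r - weight I) * \<delta> ^ (r - weight I)" by (simp add: power_mult_distrib)
      also have "\<dots> \<le> E * \<delta> ^ (r - weight I)"
        unfolding E_def using G(1) \<delta> by (intro mult_right_mono power_increasing) auto
      finally show ?thesis .
    qed
    have near: "norm (iter_bracket Z I x - iter_bracket X I x0) \<le> \<epsilon>'" if I: "I \<in> ?MI" and x: "x \<in> V"
      for I x
    proof -
      let ?X = "iter_bracket X I" and ?Y = "iter_bracket ?S I"
      have pow: "dist y x0 ^ (r - weight I) \<le> 1" if "y \<in> V" for y
        using that GR by (intro power_le_one) (auto simp: V_def dist_commute)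
      have x0V: "x0 \<in> V" using x0\<Omega> G(1) \<delta>(1) by (simp add: V_def)
      have XY: "norm (?X y - ?Y y) \<le> \<epsilon> * 1" if "y \<in> V" for y
      proof -
        have "norm (?X y - ?Y y) \<le> \<epsilon> * dist y x0 ^ (r - weight I)" using e[OF I] VR[OF that] by blast
        also have "\<dots> \<le> \<epsilon> * 1" using pow[OF that] \<epsilon>(1) by (intro mult_left_mono) auto
        finally show ?thesis .
      qed
      have "norm (?X x - ?Y x) \<le> \<epsilon> * 1"
        by (rule XY[OF x])
      moreover have "norm (?X x0 - ?Y x0) \<le> \<epsilon> * 1"
        by (rule XY[OF x0V])
      moreover have "norm (?Y x - ?Y x0) \<le> \<epsilon>" using e[OF I] VR[OF x] by blast
      \<comment> \<open>The oscillation of the commutator of X is estimated by a detour through the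
        smooth one. At weight \<open>r\<close> the power of the distance is 1 even at
        \<open>x0\<close>, so the last difference too is bounded by \<epsilon>.\<close>
      moreover have "?X x - ?X x0 = (?X x - ?Y x) + (?Y x - ?Y x0) - (?X x0 - ?Y x0)"
        "?Y x - ?X x0 = (?Y x - ?Y x0) - (?X x0 - ?Y x0)" by simp_all
      ultimately show ?thesis using YZ \<epsilon>
        by (smt (verit) norm_triangle_ineq norm_triangle_ineq4)
    qed
    have lin: "det (\<chi> k. iter_bracket Z (\<I> k) x) \<noteq> 0 \<and>
        (\<forall>w k. \<bar>cramer_coeff (\<lambda>k. iter_bracket Z (\<I> k) x) w k\<bar> \<le> L * norm w)" if "x \<in> V" for x
      using e[OF \<I>(1)] x0\<Omega> near[OF \<I>(1) that] \<I>(2) by (intro L(2)[of "\<lambda>k. iter_bracket X (\<I> k) x0"]) auto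
    show ?thesis unfolding D_def
    proof (rule curve_class_transfer[where \<I> = \<I>, OF \<phi>(1) \<delta>(1) \<delta>1 L(1) E \<I>(1) V])
      show "continuous_on V (iter_bracket Y I)" "continuous_on V (iter_bracket Z I)" if "I \<in> ?MI" for I
        using e[OF that] YZ by (auto simp: V_def intro: continuous_on_subset)
      show "norm (iter_bracket Y I x - iter_bracket Z I x) \<le> E * \<delta> ^ (r - weight I)" if "I \<in> ?MI"
        "x \<in> V" for I x
        using diff[OF that] YZ by (auto simp: norm_minus_commute)
    qed (use lin in auto)
  qed
  \<comment> \<open>The first inclusion is the transfer from S to X at radius
    \<open>\<rho> / D\<close>, which is still below \<open>r0\<close> because D is at least
    1.\<close>
  show ?thesis
  proof (rule exI[of _ "1 / D"], rule exI[of _ D], rule exI[of _ r0], intro conjI allI impI ballI; (elim conjE)?)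
    fix X :: "nat \<Rightarrow> real ^ 'p \<Rightarrow> real ^ 'p" and x0 \<rho>
    assume X: "assumption_A1 \<Omega> n r X" "controlled_by \<Omega> \<Omega>' n r K \<omega> c0 X" and x0: "x0 \<in> \<Omega>'"
      and \<rho>: "0 < \<rho>" "\<rho> < r0"
    have D0: "0 < D" using D by linarith
    have "1 / D * \<rho> \<le> \<rho>" using D \<rho>(1) by (simp add: field_simps)
    then have "cc_ball \<Omega> n r (approx_field r X x0) x0 (1 / D * \<rho>) \<subseteq> cc_ball \<Omega> n r X x0 (D * (1 / D * \<rho>))"
      using transfer[OF X x0] \<rho>(2) by (intro cc_ball_subsetI[OF _ D0]) auto
    then show "cc_ball \<Omega> n r (approx_field r X x0) x0 (1 / D * \<rho>) \<subseteq> cc_ball \<Omega> n r X x0 \<rho>"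
      using D0 by simp
    show "cc_ball \<Omega> n r X x0 \<rho> \<subseteq> cc_ball \<Omega> n r (approx_field r X x0) x0 (D * \<rho>)"
      using transfer[OF X x0] \<rho>(2) by (intro cc_ball_subsetI[OF _ D0]) auto
  qed (use D r0 in auto)
qed

end
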